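(* Let $q\ge 1$. Let $\delta,\sigma$ be the derivations of $H^*(\mathrm{D}^\infty\mathrm{W}_q)$ defined in the context, let $H^*(\mathrm{D}^\infty\mathrm{W}_q)^k$ be the subspace of elements of order $k$, and let $F_{\lambda,k}\subset H^*(\mathrm{D}^\infty\mathrm{W}_q)^k$ be the $\lambda$-eigenspace of $\delta\circ\sigma$ on $H^*(\mathrm{D}^\infty\mathrm{W}_q)^k$. Put $\lambda_{m,k}=\frac12(m-1)(2k-m)$ for $1\le m\le k$. 1) $H^*(\mathrm{D}^\infty\mathrm{W}_q)^0=F_{0,0}$, and if $k\geq1$, then $H^*(\mathrm{D}^\infty\mathrm{W}_q)^k=\bigoplus_{m=1}^kF_{\lambda_{m,k},k}$. 2) The derivation $\sigma$ is an isomorphism onto its image when restricted to $\bigoplus_{n\geq1,\,k\geq2}F_{n,k}$ ($n,k$ integers). The derivation $\delta$ is an isomorphism onto its image when restricted to $\bigoplus_{k\geq1}H^*(\mathrm{D}^\infty\mathrm{W}_q)^k$. 3) Let $k\geq1$ and let $p_{m,k}$ denote the projector from $H^*(\mathrm{D}^\infty\mathrm{W}_q)^k$ onto $F_{\lambda_{m,k},k}$ given by the decomposition in 1). Then \[ p_{1,k}=\sum_{i=0}^{k-1}(-1)^i\frac{2^i(2k-i-2)!}{(2k-2)!\,i!}\,\delta^i\circ\sigma^i, \] \[ p_{k-a,k}=\frac{2^{k-a-1}(2a+1)!}{(k-a-1)!\,(k+a)!}\,\delta^{k-a-1}\circ p_{1,a+1}\circ\sigma^{k-a-1}\qquad(0\leq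 a\leq k-1). \]
   Context: Let $\widetilde{\mathrm{D}^\infty\mathrm{W}}_q=\bigwedge[h_{i,(a)}]\otimes\mathbb{R}[c_{i,(b)}]$ ($1\le i\le q$, $a,b\ge0$ integers) be the free graded-commutative $\mathbb{R}$-algebra with $h_{i,(a)}$ odd (degree 1) and $c_{i,(b)}$ even (degree 2), with the differential $d$ (signed derivation) $dh_{i,(a)}=c_{i,(a)}$, $dc_{i,(a)}=0$. The order is the additive grading with $\mathrm{ord}(c_{i,(a)})=\mathrm{ord}(h_{i,(a)})=a$. Let $\widetilde\delta,\widetilde\sigma$ be the unsigned derivations with $\widetilde\delta(c_{i,(a)})=c_{i,(a+1)}$, $\widetilde\delta(h_{i,(a)})=h_{i,(a+1)}$, $\widetilde\sigma(c_{i,(a)})=\frac12a(a-1)c_{i,(a-1)}$, $\widetilde\sigma(h_{i,(a)})=\frac12a(a-1)h_{i,(a-1)}$ (zero for $a=0$). Define a weight on monomials, additive under products, by $\|c_{i,(l)}\|=\max\{i-l,0\}$, $\|h_{i,(0)}\|=0$, $\|h_{i,(l)}\|=\max\{i-l,0\}$ for $l\ge1$. Let $\mathscr{I}$ be the ideal generated by all $\widetilde\delta^k(m)$, $k\ge0$, $m$ a monomial with $\|m\|>q$, and set $\mathrm{D}^\infty\mathrm{W}_q=\widetilde{\mathrm{D}^\infty\mathrm{W}}_q/\mathscr{I}$. The maps $d,\widetilde\delta,\widetilde\sigma$ preserve $\mathscr{I}$, and $\widetilde\delta,\widetilde\sigma$ commute with $d$; the induced derivations on $H^*(\mathrm{D}^\infty\mathrm{W}_q)$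 are denoted $\delta,\sigma$. The order induces a grading on $H^*(\mathrm{D}^\infty\mathrm{W}_q)$. *)

theory Defs
  imports Complex_Main "HOL-Library.Poly_Mapping" "HOL-Library.Cardinality"
begin

section \<open>Free associative algebras and ideals\<close>

instantiation poly_mapping :: (type, real_vector) real_vector
begin

lift_definition scaleR_poly_mapping :: "real \<Rightarrow> ('a \<Rightarrow>\<^sub>0 'b) \<Rightarrow> ('a \<Rightarrow>\<^sub>0 'b)"
  is "\<lambda>r f k. r *\<^sub>R f k"
  by (rule finite_subset[rotated]) auto

instance
  by standard (transfer; simp add: fun_eq_iff scaleR_add_right scaleR_add_left)+

end

lemma lookup_scaleR [simp]: "Poly_Mapping.lookup (r *\<^sub>R f) k = r *\<^sub>R Poly_Mapping.lookup f k"
  by transfer simp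

definition lin_ext :: "('a \<Rightarrow> 'v::real_vector) \<Rightarrow> ('a \<Rightarrow>\<^sub>0 real) \<Rightarrow> 'v"
  where "lin_ext f x = (\<Sum>w\<in>Poly_Mapping.keys x. Poly_Mapping.lookup x w *\<^sub>R f w)"

lemma lin_ext_superset:
  assumes "finite A" "Poly_Mapping.keys x \<subseteq> A"
  shows "lin_ext f x = (\<Sum>w\<in>A. Poly_Mapping.lookup x w *\<^sub>R f w)"
  unfolding lin_ext_def using assms
  by (intro sum.mono_neutral_left) (auto simp: in_keys_iff)

lemma linear_lin_ext: "linear (lin_ext f)"
proof (rule linearI)
  fix x y :: "'a \<Rightarrow>\<^sub>0 real" and r :: real
  let ?A = "Poly_Mapping.keys x \<union> Poly_Mapping.keys y"
  have "lin_ext f (x + y) = (\<Sum>w\<in>?A. Poly_Mapping.lookup (x + y) w *\<^sub>R f w)"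
    by (rule lin_ext_superset) (auto simp: Poly_Mapping.keys_add)
  also have "\<dots> = (\<Sum>w\<in>?A. Poly_Mapping.lookup x w *\<^sub>R f w) + (\<Sum>w\<in>?A. Poly_Mapping.lookup y w *\<^sub>R f w)"
    by (simp add: lookup_add scaleR_add_left sum.distrib)
  also have "\<dots> = lin_ext f x + lin_ext f y"
    by (simp add: lin_ext_superset[of ?A])
  finally show "lin_ext f (x + y) = lin_ext f x + lin_ext f y" .
  have "lin_ext f (r *\<^sub>R x) = (\<Sum>w\<in>Poly_Mapping.keys x. Poly_Mapping.lookup (r *\<^sub>R x) w *\<^sub>R f w)"
    by (rule lin_ext_superset) (auto simp: in_keys_iff)
  then show "lin_ext f (r *\<^sub>R x) = r *\<^sub>R lin_ext f x"
    by (simp add: lin_ext_def scaleR_sum_right)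
qed

lemma lin_ext_single: "lin_ext f (Poly_Mapping.single w 1) = f w"
  by (simp add: lin_ext_def)

lemma poly_mapping_lin_ext_self: "lin_ext (\<lambda>w. Poly_Mapping.single w 1) x = (x :: 'a \<Rightarrow>\<^sub>0 real)"
  by (rule poly_mapping_eqI)
     (auto simp: lin_ext_def lookup_sum lookup_single when_def in_keys_iff if_distrib cong: if_cong)

lemma linear_eq_on_singles:
  fixes f g :: "('a \<Rightarrow>\<^sub>0 real) \<Rightarrow> 'v::real_vector"
  assumes f: "linear f" and g: "linear g"
    and eq: "\<And>w. f (Poly_Mapping.single w 1) = g (Poly_Mapping.single w 1)"
  shows "f x = g x"
proof -
  have "f (lin_ext (\<lambda>w. Poly_Mapping.single w 1) x) = g (lin_ext (\<lambda>w. Poly_Mapping.single w 1) x)"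
    unfolding lin_ext_def
    by (simp add: linear_sum[OF f] linear_sum[OF g] linear_scale[OF f] linear_scale[OF g] eq)
  then show ?thesis by (simp only: poly_mapping_lin_ext_self)
qed

text \<open>Words, with concatenation as (non-commutative) addition, so that \<open>'a word \<Rightarrow>\<^sub>0 real\<close>
  with the convolution product is the free associative real algebra.\<close>

datatype 'a word = Word (letters: "'a list")

instantiation word :: (type) monoid_add
begin
definition "0 = Word []"
definition "u + v = Word (letters u @ letters v)"
instance by standard (simp_all add: zero_word_def plus_word_def)
end

lemma poly_mapping_sum_single: "x = (\<Sum>k\<in>Poly_Mapping.keys x. Poly_Mapping.single k (Poly_Mapping.lookup x k))"
  by (rule poly_mapping_eqI)
     (auto simp: lookup_sum lookup_single when_def in_keys_iff sum.delta)

instance poly_mapping :: (monoid_add, real_algebra_1) real_algebra_1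
proof
  fix r :: real and x y :: "'a \<Rightarrow>\<^sub>0 'b"
  have s: "r *\<^sub>R Poly_Mapping.single k a = Poly_Mapping.single k (r *\<^sub>R a)" for k :: 'a and a :: 'b
    by (rule poly_mapping_eqI) (simp add: lookup_single when_def)
  let ?x = "\<Sum>k\<in>Poly_Mapping.keys x. Poly_Mapping.single k (Poly_Mapping.lookup x k)"
  let ?y = "\<Sum>k\<in>Poly_Mapping.keys y. Poly_Mapping.single k (Poly_Mapping.lookup y k)"
  have "r *\<^sub>R ?x * ?y = r *\<^sub>R (?x * ?y)"
    by (simp add: sum_product scaleR_sum_right s mult_single)
  then show "r *\<^sub>R x * y = r *\<^sub>R (x * y)"
    by (simp flip: poly_mapping_sum_single)
  have "?x * r *\<^sub>R ?y = r *\<^sub>R (?x * ?y)"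
    by (simp add: sum_product scaleR_sum_right s mult_single)
  then show "x * r *\<^sub>R y = r *\<^sub>R (x * y)"
    by (simp flip: poly_mapping_sum_single)
qed

definition ideal_gen :: "'a::{real_algebra, monoid_mult} set \<Rightarrow> 'a set"
  where "ideal_gen S = span {x * s * y | x s y. s \<in> S}"

lemma subspace_ideal_gen: "subspace (ideal_gen S)"
  by (simp add: ideal_gen_def)

lemma ideal_gen_base: "s \<in> S \<Longrightarrow> x * s * y \<in> ideal_gen S"
  unfolding ideal_gen_def by (rule span_base) blast

lemma ideal_gen_superset: "s \<in> S \<Longrightarrow> s \<in> ideal_gen S"
  using ideal_gen_base[of s S 1 1] by simp

lemma ideal_gen_linear:
  assumes f: "linear f" and g: "\<And>x s y. s \<in> S \<Longrightarrow> f (x * s * y) \<in> T"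
    and T: "subspace T" and z: "z \<in> ideal_gen S"
  shows "f z \<in> T"
proof -
  have "f z \<in> f ` span {x * s * y | x s y. s \<in> S}"
    using z by (simp add: ideal_gen_def)
  also have "\<dots> = span (f ` {x * s * y | x s y. s \<in> S})"
    by (rule linear_span_image[OF f, symmetric])
  also have "\<dots> \<subseteq> T"
    by (rule span_minimal[OF _ T]) (use g in blast)
  finally show ?thesis .
qed

lemma ideal_gen_mult_left: "z \<in> ideal_gen S \<Longrightarrow> a * z \<in> ideal_gen S"
proof (rule ideal_gen_linear[where f = "\<lambda>z. a * z"])
  show "linear (\<lambda>z. a * z)" by (auto intro!: linearI simp: algebra_simps)
  show "a * (x * s * y) \<in> ideal_gen S" if "s \<in> S" for x s y
    using ideal_gen_base[OF that, of "a * x" y] by (simp add: mult.assoc)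
qed (auto simp: subspace_ideal_gen)

lemma ideal_gen_mult_right: "z \<in> ideal_gen S \<Longrightarrow> z * a \<in> ideal_gen S"
proof (rule ideal_gen_linear[where f = "\<lambda>z. z * a"])
  show "linear (\<lambda>z. z * a)" by (auto intro!: linearI simp: algebra_simps)
  show "x * s * y * a \<in> ideal_gen S" if "s \<in> S" for x s y
    using ideal_gen_base[OF that, of x "y * a"] by (simp add: mult.assoc)
qed (auto simp: subspace_ideal_gen)

lemma ideal_gen_derivation:
  assumes D: "linear D" "\<And>x y. D (x * y) = D x * y + e x * D y"
    and e: "\<And>x y. e (x * y) = e x * e y"
    and S: "\<And>s. s \<in> S \<Longrightarrow> D s \<in> ideal_gen S" "\<And>s. s \<in> S \<Longrightarrow> e s \<in> ideal_gen S"
    and z: "z \<in> ideal_gen S"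
  shows "D z \<in> ideal_gen S"
proof (rule ideal_gen_linear[OF D(1) _ subspace_ideal_gen z])
  fix x s y assume s: "s \<in> S"
  have "D (x * s * y) = D x * s * y + e x * D s * y + e x * e s * D y"
    by (simp add: D(2) e algebra_simps)
  moreover have "D x * s * y \<in> ideal_gen S" by (rule ideal_gen_base[OF s])
  moreover have "e x * D s * y \<in> ideal_gen S"
    by (intro ideal_gen_mult_left ideal_gen_mult_right S(1)[OF s])
  moreover have "e x * e s * D y \<in> ideal_gen S"
    by (intro ideal_gen_mult_left ideal_gen_mult_right S(2)[OF s])
  ultimately show "D (x * s * y) \<in> ideal_gen S"
    by (simp add: subspace_add[OF subspace_ideal_gen])
qed

lemma ideal_gen_endo:
  assumes e: "linear e" "\<And>x y. e (x * y) = e x * e y"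
    and S: "\<And>s. s \<in> S \<Longrightarrow> e s \<in> ideal_gen S" and z: "z \<in> ideal_gen S"
  shows "e z \<in> ideal_gen S"
proof (rule ideal_gen_linear[OF e(1) _ subspace_ideal_gen z])
  fix x s y assume s: "s \<in> S"
  show "e (x * s * y) \<in> ideal_gen S"
    by (simp add: e(2) ideal_gen_mult_left ideal_gen_mult_right S[OF s])
qed

lemma equivp_diff_subspace:
  assumes "subspace (U :: 'a::real_vector set)"
  shows "equivp (\<lambda>x y. x - y \<in> U)"
proof (rule equivpI)
  show "reflp (\<lambda>x y. x - y \<in> U)"
    using subspace_0[OF assms] by (simp add: reflp_def)
  show "symp (\<lambda>x y. x - y \<in> U)"
    by (rule sympI) (drule subspace_neg[OF assms], simp)
  show "transp (\<lambda>x y. x - y \<in> U)"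
    by (rule transpI) (drule subspace_add[OF assms], assumption, simp)
qed

lemma diff_mult_mem_ideal_gen:
  assumes "x - x' \<in> ideal_gen S" "y - y' \<in> ideal_gen S"
  shows "x * y - x' * y' \<in> ideal_gen S"
proof -
  have "x * y - x' * y' = (x - x') * y + x' * (y - y')" by (simp add: algebra_simps)
  then show ?thesis
    using assms by (simp add: subspace_add[OF subspace_ideal_gen] ideal_gen_mult_left ideal_gen_mult_right)
qed

lemma subspace_diff_add:
  "subspace U \<Longrightarrow> x - x' \<in> U \<Longrightarrow> y - y' \<in> U \<Longrightarrow> (x + y) - (x' + y') \<in> U"
  using subspace_add[of U "x - x'" "y - y'"] by (simp add: algebra_simps)

lemma subspace_diff_diff:
  "subspace U \<Longrightarrow> x - x' \<in> U \<Longrightarrow> y - y' \<in> U \<Longrightarrow> (x - y) - (x' - y') \<in> U"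
  using subspace_diff[of U "x - x'" "y - y'"] by (simp add: algebra_simps)

lemma subspace_diff_uminus:
  "subspace U \<Longrightarrow> x - x' \<in> U \<Longrightarrow> (- x) - (- x') \<in> U"
  using subspace_neg[of U "x - x'"] by simp

lemma subspace_diff_scaleR:
  "subspace U \<Longrightarrow> x - x' \<in> U \<Longrightarrow> r *\<^sub>R x - r *\<^sub>R x' \<in> U"
  using subspace_scale[of U "x - x'" r] by (simp add: scaleR_diff_right)

section \<open>The free graded-commutative algebra\<close>

text \<open>The type parameter \<open>'q\<close> carries the integer \<open>q = CARD('q) \<ge> 1\<close>.\<close>

typedef ('q::finite) idx = "{1..CARD('q)}"
  by (rule exI[of _ 1]) (simp add: Suc_leI)

datatype ('q::finite) gen = Hgen "'q idx" nat | Cgen "'q idx" nat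

primrec odd_gen :: "'q::finite gen \<Rightarrow> bool" where
  "odd_gen (Hgen i a) = True"
| "odd_gen (Cgen i a) = False"

type_synonym 'q assoc_alg = "'q gen word \<Rightarrow>\<^sub>0 real"

definition wd :: "'q::finite gen list \<Rightarrow> 'q assoc_alg"
  where "wd gs = Poly_Mapping.single (Word gs) 1"

lemma wd_Nil: "wd [] = 1"
  unfolding wd_def by (metis single_one zero_word_def)

lemma wd_append: "wd (gs @ hs) = wd gs * wd hs"
  by (simp add: wd_def mult_single plus_word_def)

lemma wd_Cons: "wd (g # gs) = wd [g] * wd gs"
  using wd_append[of "[g]" gs] by simp

lemma linear_comp': "linear f \<Longrightarrow> linear g \<Longrightarrow> linear (\<lambda>x. f (g x))"
  using linear_compose[of g f] by (simp add: o_def)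

lemma linear_eq_on_wd:
  assumes "linear f" "linear g" "\<And>gs. f (wd gs) = g (wd gs)"
  shows "f x = g x"
  using assms(1,2)
proof (rule linear_eq_on_singles)
  fix w :: "'a gen word"
  show "f (Poly_Mapping.single w 1) = g (Poly_Mapping.single w 1)"
    using assms(3)[of "letters w"] by (simp add: wd_def)
qed

definition koszul :: "'q::finite gen \<Rightarrow> 'q gen \<Rightarrow> real"
  where "koszul g g' = (if odd_gen g \<and> odd_gen g' then - 1 else 1)"

definition gc_ideal :: "'q::finite assoc_alg set"
  where "gc_ideal = ideal_gen {wd [g, g'] - koszul g g' *\<^sub>R wd [g', g] | g g'. True}"

text \<open>The relations \<open>g g' = \<plusminus> g' g\<close> force odd generators to square to zero because \<open>2\<close> is
  invertible, so the quotient is \<open>\<And>[h] \<otimes> \<real>[c]\<close>.\<close>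

quotient_type (overloaded) 'q free_DW = "'q::finite assoc_alg" / "\<lambda>x y. x - y \<in> gc_ideal"
  unfolding gc_ideal_def by (rule equivp_diff_subspace[OF subspace_ideal_gen])

lemma subspace_gc_ideal: "subspace gc_ideal"
  by (simp add: gc_ideal_def subspace_ideal_gen)

instantiation free_DW :: (finite) "{real_algebra, monoid_mult}"
begin

lift_definition zero_free_DW :: "'a free_DW" is 0 .
lift_definition one_free_DW :: "'a free_DW" is 1 .
lift_definition plus_free_DW :: "'a free_DW \<Rightarrow> 'a free_DW \<Rightarrow> 'a free_DW" is "(+)"
  by (rule subspace_diff_add[OF subspace_gc_ideal])
lift_definition minus_free_DW :: "'a free_DW \<Rightarrow> 'a free_DW \<Rightarrow> 'a free_DW" is "(-)"
  by (rule subspace_diff_diff[OF subspace_gc_ideal])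
lift_definition uminus_free_DW :: "'a free_DW \<Rightarrow> 'a free_DW" is uminus
  by (rule subspace_diff_uminus[OF subspace_gc_ideal])
lift_definition times_free_DW :: "'a free_DW \<Rightarrow> 'a free_DW \<Rightarrow> 'a free_DW" is "(*)"
  unfolding gc_ideal_def by (rule diff_mult_mem_ideal_gen)
lift_definition scaleR_free_DW :: "real \<Rightarrow> 'a free_DW \<Rightarrow> 'a free_DW" is "(*\<^sub>R)"
  by (rule subspace_diff_scaleR[OF subspace_gc_ideal])

instance
  by standard (transfer, simp add: algebra_simps subspace_0[OF subspace_gc_ideal])+

end

lift_definition gen :: "'q::finite gen \<Rightarrow> 'q free_DW" is "\<lambda>g. wd [g]" .

definition monomial :: "'q::finite gen list \<Rightarrow> 'q free_DW"
  where "monomial gs = prod_list (map gen gs)"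

lemma abs_wd: "abs_free_DW (wd gs) = monomial gs"
proof (induction gs)
  case Nil
  then show ?case by (simp add: monomial_def wd_Nil one_free_DW_def)
next
  case (Cons g gs)
  then show ?case
    by (subst wd_Cons)
       (simp add: monomial_def gen_def times_free_DW.abs_eq[symmetric])
qed

lemma linear_abs_free_DW: "linear (abs_free_DW :: 'q::finite assoc_alg \<Rightarrow> _)"
  by (rule linearI) (simp_all add: plus_free_DW.abs_eq scaleR_free_DW.abs_eq)

lemma linear_eq_on_monomials:
  assumes "linear f" "linear g" "\<And>gs. f (monomial gs) = g (monomial gs)"
  shows "f x = g x"
proof -
  have "f (abs_free_DW (rep_free_DW x)) = g (abs_free_DW (rep_free_DW x))"
    by (rule linear_eq_on_wd)
       (simp_all add: linear_comp'[OF assms(1) linear_abs_free_DW]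
         linear_comp'[OF assms(2) linear_abs_free_DW] abs_wd assms(3))
  then show ?thesis
    by (simp add: Quotient_abs_rep[OF Quotient_free_DW])
qed

lemma gen_commute: "gen g * gen g' = koszul g g' *\<^sub>R (gen g' * gen g)"
proof -
  have "wd [g, g'] - koszul g g' *\<^sub>R wd [g', g] \<in> gc_ideal"
    unfolding gc_ideal_def by (rule ideal_gen_superset) blast
  then have "abs_free_DW (wd [g, g']) = abs_free_DW (koszul g g' *\<^sub>R wd [g', g])"
    by (simp add: free_DW.abs_eq_iff)
  then show ?thesis
    by (simp add: scaleR_free_DW.abs_eq[symmetric] abs_wd monomial_def)
qed

section \<open>Derivations\<close>

text \<open>\<open>word_bar e\<close> multiplies an element of parity \<open>p\<close> by \<open>e ^ p\<close>, and \<open>word_der e D\<close> is the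
  linear map extending \<open>D\<close> with \<open>word_der e D (x * y) = word_der e D x * y + word_bar e x * word_der e D y\<close>:
  a derivation for \<open>e = 1\<close>, a signed derivation for \<open>e = - 1\<close>.\<close>

definition gen_sign :: "real \<Rightarrow> 'q::finite gen \<Rightarrow> real"
  where "gen_sign e g = (if odd_gen g then e else 1)"

primrec list_der :: "real \<Rightarrow> ('q::finite gen \<Rightarrow> 'q assoc_alg) \<Rightarrow> 'q gen list \<Rightarrow> 'q assoc_alg" where
  "list_der e D [] = 0"
| "list_der e D (g # gs) = D g * wd gs + gen_sign e g *\<^sub>R (wd [g] * list_der e D gs)"

definition word_der :: "real \<Rightarrow> ('q::finite gen \<Rightarrow> 'q assoc_alg) \<Rightarrow> 'q assoc_alg \<Rightarrow> 'q assoc_alg"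
  where "word_der e D = lin_ext (\<lambda>w. list_der e D (letters w))"

definition word_bar :: "real \<Rightarrow> 'q::finite assoc_alg \<Rightarrow> 'q assoc_alg"
  where "word_bar e = lin_ext (\<lambda>w. prod_list (map (gen_sign e) (letters w)) *\<^sub>R wd (letters w))"

lemma linear_word_der: "linear (word_der e D)"
  unfolding word_der_def by (rule linear_lin_ext)

lemma linear_word_bar: "linear (word_bar e)"
  unfolding word_bar_def by (rule linear_lin_ext)

lemma word_der_wd: "word_der e D (wd gs) = list_der e D gs"
  by (simp add: word_der_def wd_def lin_ext_single)

lemma word_bar_wd: "word_bar e (wd gs) = prod_list (map (gen_sign e) gs) *\<^sub>R wd gs"
  by (subst wd_def) (simp add: word_bar_def lin_ext_single)

lemma linear_mult_left': "linear f \<Longrightarrow> linear (\<lambda>x. a * f x :: 'a::real_algebra)"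
  by (auto intro!: linearI simp: linear_add linear_scale algebra_simps)

lemma linear_mult_right': "linear f \<Longrightarrow> linear (\<lambda>x. f x * a :: 'a::real_algebra)"
  by (auto intro!: linearI simp: linear_add linear_scale algebra_simps)

lemmas linear_intros = linear_compose_scale_right linear_mult_left' linear_mult_right' linear_compose_add linear_compose_sub
  linear_word_der linear_word_bar linear_ident

lemma list_der_append:
  "list_der e D (gs @ hs)
   = list_der e D gs * wd hs + (prod_list (map (gen_sign e) gs) *\<^sub>R wd gs) * list_der e D hs"
proof (induction gs)
  case Nil
  then show ?case by (simp add: wd_Nil)
next
  case (Cons g gs)
  have "list_der e D ((g # gs) @ hs)
     = D g * wd gs * wd hs + gen_sign e g *\<^sub>R (wd [g] * (list_der e D gs * wd hs
        + (prod_list (map (gen_sign e) gs) *\<^sub>R wd gs) * list_der e D hs))"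
    by (simp add: Cons.IH wd_append mult.assoc)
  also have "\<dots> = list_der e D (g # gs) * wd hs
        + (prod_list (map (gen_sign e) (g # gs)) *\<^sub>R wd (g # gs)) * list_der e D hs"
    by (simp add: wd_Cons[of g gs] algebra_simps)
  finally show ?case .
qed

lemma word_der_mult:
  "word_der e D (x * y) = word_der e D x * y + word_bar e x * word_der e D y"
proof -
  have 1: "word_der e D (wd gs * y) = word_der e D (wd gs) * y + word_bar e (wd gs) * word_der e D y"
    for gs
    by (rule linear_eq_on_wd[where x = y])
       (auto intro!: linear_intros linear_comp'[OF linear_word_der]
         simp: word_der_wd word_bar_wd list_der_append simp flip: wd_append)
  show ?thesis
    by (rule linear_eq_on_wd[where x = x])
       (auto intro!: linear_intros linear_comp'[OF linear_word_der] simp: 1)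
qed

lemma word_bar_mult: "word_bar e (x * y) = word_bar e x * word_bar e y"
proof -
  have 1: "word_bar e (wd gs * y) = word_bar e (wd gs) * word_bar e y" for gs
    by (rule linear_eq_on_wd[where x = y])
       (auto intro!: linear_intros linear_comp'[OF linear_word_bar]
         simp: word_bar_wd algebra_simps simp flip: wd_append)
  show ?thesis
    by (rule linear_eq_on_wd[where x = x])
       (auto intro!: linear_intros linear_comp'[OF linear_word_bar] simp: 1)
qed

lemma word_bar_gc_ideal: "x \<in> gc_ideal \<Longrightarrow> word_bar e x \<in> gc_ideal"
  unfolding gc_ideal_def
proof (rule ideal_gen_endo[OF linear_word_bar word_bar_mult])
  fix s assume "s \<in> {wd [g, g'] - koszul g g' *\<^sub>R wd [g', g] | g g' :: 'a gen. True}"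
  then obtain g g' :: "'a gen" where s: "s = wd [g, g'] - koszul g g' *\<^sub>R wd [g', g]" by blast
  have "word_bar e s = (gen_sign e g * gen_sign e g') *\<^sub>R s"
    by (simp add: s linear_diff[OF linear_word_bar] linear_scale[OF linear_word_bar] word_bar_wd
        scaleR_diff_right mult.commute)
  moreover have "s \<in> ideal_gen {wd [g, g'] - koszul g g' *\<^sub>R wd [g', g] | g g' :: 'a gen. True}"
    by (rule ideal_gen_superset) (use s in blast)
  ultimately show "word_bar e s \<in> ideal_gen {wd [g, g'] - koszul g g' *\<^sub>R wd [g', g] | g g'. True}"
    by (simp add: subspace_scale[OF subspace_ideal_gen])
qed

lemma gc_rel: "wd [g] * wd [g'] - koszul g g' *\<^sub>R (wd [g'] * wd [g]) \<in> gc_ideal"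
  unfolding gc_ideal_def wd_Cons[of g "[g']", symmetric] wd_Cons[of g' "[g]", symmetric]
  by (rule ideal_gen_superset) blast

lemma word_der_gc_ideal:
  assumes D: "\<And>g g'. D g * wd [g'] + gen_sign e g *\<^sub>R (wd [g] * D g')
      - koszul g g' *\<^sub>R (D g' * wd [g] + gen_sign e g' *\<^sub>R (wd [g'] * D g)) \<in> gc_ideal"
    and x: "x \<in> gc_ideal"
  shows "word_der e D x \<in> gc_ideal"
  unfolding gc_ideal_def
proof (rule ideal_gen_derivation[OF linear_word_der word_der_mult word_bar_mult])
  fix s assume "s \<in> {wd [g, g'] - koszul g g' *\<^sub>R wd [g', g] | g g' :: 'a gen. True}"
  then obtain g g' :: "'a gen" where s: "s = wd [g, g'] - koszul g g' *\<^sub>R wd [g', g]" by auto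
  show "word_der e D s \<in> ideal_gen {wd [g, g'] - koszul g g' *\<^sub>R wd [g', g] | g g'. True}"
    using D[of g g']
    by (simp add: s linear_diff[OF linear_word_der] linear_scale[OF linear_word_der] word_der_wd
        wd_Nil gc_ideal_def)
  have "s \<in> gc_ideal"
    unfolding gc_ideal_def by (rule ideal_gen_superset) (use s in blast)
  then show "word_bar e s \<in> ideal_gen {wd [g, g'] - koszul g g' *\<^sub>R wd [g', g] | g g'. True}"
    using word_bar_gc_ideal by (simp add: gc_ideal_def)
qed (use x in \<open>simp add: gc_ideal_def\<close>)

primrec d_gen :: "'q::finite gen \<Rightarrow> 'q assoc_alg" where
  "d_gen (Hgen i a) = wd [Cgen i a]"
| "d_gen (Cgen i a) = 0"

primrec delta_gen :: "'q::finite gen \<Rightarrow> 'q assoc_alg" where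
  "delta_gen (Hgen i a) = wd [Hgen i (a + 1)]"
| "delta_gen (Cgen i a) = wd [Cgen i (a + 1)]"

primrec sigma_gen :: "'q::finite gen \<Rightarrow> 'q assoc_alg" where
  "sigma_gen (Hgen i a) = (1 / 2 * real a * (real a - 1)) *\<^sub>R wd [Hgen i (a - 1)]"
| "sigma_gen (Cgen i a) = (1 / 2 * real a * (real a - 1)) *\<^sub>R wd [Cgen i (a - 1)]"

lemma word_der_1_shift_gc_ideal:
  assumes D: "\<And>g. D g = r g *\<^sub>R wd [f g]" and odd: "\<And>g. odd_gen (f g) = odd_gen g"
    and x: "x \<in> gc_ideal"
  shows "word_der 1 D x \<in> gc_ideal"
proof (rule word_der_gc_ideal[OF _ x])
  fix g g' :: "'a gen"
  have k: "koszul (f g) g' = koszul g g'" "koszul g (f g') = koszul g g'"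
    by (simp_all add: koszul_def odd)
  have "r g *\<^sub>R (wd [f g] * wd [g'] - koszul g g' *\<^sub>R (wd [g'] * wd [f g]))
      + r g' *\<^sub>R (wd [g] * wd [f g'] - koszul g g' *\<^sub>R (wd [f g'] * wd [g])) \<in> gc_ideal"
    using gc_rel[of "f g" g'] gc_rel[of g "f g'"]
    by (simp add: k subspace_add[OF subspace_gc_ideal] subspace_scale[OF subspace_gc_ideal])
  then show "D g * wd [g'] + gen_sign 1 g *\<^sub>R (wd [g] * D g')
      - koszul g g' *\<^sub>R (D g' * wd [g] + gen_sign 1 g' *\<^sub>R (wd [g'] * D g)) \<in> gc_ideal"
    by (simp add: D gen_sign_def algebra_simps)
qed

lemma word_der_delta_gc_ideal: "x \<in> gc_ideal \<Longrightarrow> word_der 1 delta_gen x \<in> gc_ideal"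
proof (rule word_der_1_shift_gc_ideal)
  fix g :: "'a gen"
  let ?f = "case_gen (\<lambda>i a. Hgen i (a + 1)) (\<lambda>i a. Cgen i (a + 1))"
  show "delta_gen g = (\<lambda>_. 1) g *\<^sub>R wd [?f g]" "odd_gen (?f g) = odd_gen g"
    by (cases g; simp)+
qed

lemma word_der_sigma_gc_ideal: "x \<in> gc_ideal \<Longrightarrow> word_der 1 sigma_gen x \<in> gc_ideal"
proof (rule word_der_1_shift_gc_ideal)
  fix g :: "'a gen"
  let ?f = "case_gen (\<lambda>i a. Hgen i (a - 1)) (\<lambda>i a. Cgen i (a - 1))"
  let ?r = "case_gen (\<lambda>i a. 1 / 2 * real a * (real a - 1)) (\<lambda>i a. 1 / 2 * real a * (real a - 1))"
  show "sigma_gen g = ?r g *\<^sub>R wd [?f g]" "odd_gen (?f g) = odd_gen g"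
    by (cases g; simp)+
qed

lemma word_der_d_gc_ideal: "x \<in> gc_ideal \<Longrightarrow> word_der (- 1) d_gen x \<in> gc_ideal"
proof (erule word_der_gc_ideal[rotated])
  fix g g' :: "'a gen"
  let ?R = "\<lambda>g g'. wd [g] * wd [g'] - koszul g g' *\<^sub>R (wd [g'] * wd [g])"
  show "d_gen g * wd [g'] + gen_sign (- 1) g *\<^sub>R (wd [g] * d_gen g')
      - koszul g g' *\<^sub>R (d_gen g' * wd [g] + gen_sign (- 1) g' *\<^sub>R (wd [g'] * d_gen g)) \<in> gc_ideal"
  proof (cases g; cases g')
    fix i a j b assume [simp]: "g = Hgen i a" "g' = Hgen j b"
    have "?R (Cgen i a) (Hgen j b) + ?R (Cgen j b) (Hgen i a) \<in> gc_ideal"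
      by (rule subspace_add[OF subspace_gc_ideal gc_rel gc_rel])
    then show ?thesis by (simp add: gen_sign_def koszul_def algebra_simps)
  next
    fix i a j b assume [simp]: "g = Hgen i a" "g' = Cgen j b"
    have "?R (Cgen i a) (Cgen j b) \<in> gc_ideal" by (rule gc_rel)
    then show ?thesis by (simp add: gen_sign_def koszul_def)
  next
    fix i a j b assume [simp]: "g = Cgen i a" "g' = Hgen j b"
    have "?R (Cgen i a) (Cgen j b) \<in> gc_ideal" by (rule gc_rel)
    then show ?thesis by (simp add: gen_sign_def koszul_def)
  qed (simp add: gen_sign_def subspace_0[OF subspace_gc_ideal])
qed

lift_definition d_free :: "'q::finite free_DW \<Rightarrow> 'q free_DW" is "word_der (- 1) d_gen"
  using word_der_d_gc_ideal by (simp flip: linear_diff[OF linear_word_der])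

lift_definition delta_free :: "'q::finite free_DW \<Rightarrow> 'q free_DW" is "word_der 1 delta_gen"
  using word_der_delta_gc_ideal by (simp flip: linear_diff[OF linear_word_der])

lift_definition sigma_free :: "'q::finite free_DW \<Rightarrow> 'q free_DW" is "word_der 1 sigma_gen"
  using word_der_sigma_gc_ideal by (simp flip: linear_diff[OF linear_word_der])

text \<open>The grading involution, needed only for the sign in the Leibniz rule of \<open>d_free\<close>.\<close>

lift_definition bar_free :: "'q::finite free_DW \<Rightarrow> 'q free_DW" is "word_bar (- 1)"
  using word_bar_gc_ideal by (simp flip: linear_diff[OF linear_word_bar])

lemma gc_0 [simp]: "0 \<in> gc_ideal"
  by (rule subspace_0[OF subspace_gc_ideal])

lemma word_bar_1: "word_bar 1 x = x"
proof (rule linear_eq_on_wd[where x = x])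
  fix gs :: "'a gen list"
  have "prod_list (map (gen_sign 1) gs) = 1" by (induction gs) (simp_all add: gen_sign_def)
  then show "word_bar 1 (wd gs) = wd gs" by (simp add: word_bar_wd)
qed (auto intro: linear_word_bar linear_ident)

lemma linear_d_free: "linear d_free"
  by (rule linearI; transfer) (simp_all add: linear_add linear_scale linear_word_der)

lemma linear_delta_free: "linear delta_free"
  by (rule linearI; transfer) (simp_all add: linear_add linear_scale linear_word_der)

lemma linear_sigma_free: "linear sigma_free"
  by (rule linearI; transfer) (simp_all add: linear_add linear_scale linear_word_der)

lemma linear_bar_free: "linear bar_free"
  by (rule linearI; transfer) (simp_all add: linear_add linear_scale linear_word_bar)

lemma d_free_mult: "d_free (x * y) = d_free x * y + bar_free x * d_free y"
  by transfer (simp add: word_der_mult)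

lemma delta_free_mult: "delta_free (x * y) = delta_free x * y + x * delta_free y"
  by transfer (simp add: word_der_mult word_bar_1)

lemma sigma_free_mult: "sigma_free (x * y) = sigma_free x * y + x * sigma_free y"
  by transfer (simp add: word_der_mult word_bar_1)

lemma bar_free_mult: "bar_free (x * y) = bar_free x * bar_free y"
  by transfer (simp add: word_bar_mult)

lemma bar_free_1: "bar_free 1 = 1"
  by transfer (simp add: word_bar_wd flip: wd_Nil)

lemma d_free_gen [simp]:
  "d_free (gen (Hgen i a)) = gen (Cgen i a)" "d_free (gen (Cgen i a)) = 0"
  by (transfer; simp add: word_der_wd wd_Nil)+

lemma delta_free_gen [simp]:
  "delta_free (gen (Hgen i a)) = gen (Hgen i (a + 1))" "delta_free (gen (Cgen i a)) = gen (Cgen i (a + 1))"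
  by (transfer; simp add: word_der_wd wd_Nil)+

lemma sigma_free_gen [simp]:
  "sigma_free (gen (Hgen i a)) = (1 / 2 * real a * (real a - 1)) *\<^sub>R gen (Hgen i (a - 1))"
  "sigma_free (gen (Cgen i a)) = (1 / 2 * real a * (real a - 1)) *\<^sub>R gen (Cgen i (a - 1))"
  by (transfer; simp add: word_der_wd wd_Nil)+

lemma bar_free_gen [simp]: "bar_free (gen g) = gen_sign (- 1) g *\<^sub>R gen g"
  by transfer (simp add: word_bar_wd)

lemma derivation_eq:
  fixes f g :: "'q::finite free_DW \<Rightarrow> 'q free_DW"
  assumes f: "linear f" "\<And>x y. f (x * y) = f x * y + b x * f y"
    and g: "linear g" "\<And>x y. g (x * y) = g x * y + b x * g y"
    and b: "b 1 = 1" and eq: "\<And>x. f (gen x) = g (gen x)"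
  shows "f x = g x"
proof (rule linear_eq_on_monomials[OF f(1) g(1)])
  fix gs :: "'q gen list"
  have "f 1 = 0" "g 1 = 0" using f(2)[of 1 1] g(2)[of 1 1] b by simp_all
  then show "f (monomial gs) = g (monomial gs)"
    by (induction gs) (simp_all add: monomial_def f(2) g(2) eq)
qed

lemma endomorphism_eq:
  fixes f g :: "'q::finite free_DW \<Rightarrow> 'q free_DW"
  assumes f: "linear f" "\<And>x y. f (x * y) = f x * f y" "f 1 = 1"
    and g: "linear g" "\<And>x y. g (x * y) = g x * g y" "g 1 = 1"
    and eq: "\<And>x. f (gen x) = g (gen x)"
  shows "f x = g x"
proof (rule linear_eq_on_monomials[OF f(1) g(1)])
  fix gs :: "'q gen list"
  show "f (monomial gs) = g (monomial gs)"
    by (induction gs) (simp_all add: monomial_def f(2,3) g(2,3) eq)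
qed

lemmas free_linear = linear_d_free linear_delta_free linear_sigma_free linear_bar_free

lemma free_simps [simp]:
  "d_free 0 = 0" "delta_free 0 = 0" "sigma_free 0 = 0" "bar_free 0 = 0"
  "d_free (x + y) = d_free x + d_free y" "delta_free (x + y) = delta_free x + delta_free y"
  "sigma_free (x + y) = sigma_free x + sigma_free y" "bar_free (x + y) = bar_free x + bar_free y"
  "d_free (x - y) = d_free x - d_free y" "delta_free (x - y) = delta_free x - delta_free y"
  "sigma_free (x - y) = sigma_free x - sigma_free y" "bar_free (x - y) = bar_free x - bar_free y"
  "d_free (- x) = - d_free x" "delta_free (- x) = - delta_free x"
  "sigma_free (- x) = - sigma_free x" "bar_free (- x) = - bar_free x"
  "d_free (r *\<^sub>R x) = r *\<^sub>R d_free x" "delta_free (r *\<^sub>R x) = r *\<^sub>R delta_free x"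
  "sigma_free (r *\<^sub>R x) = r *\<^sub>R sigma_free x" "bar_free (r *\<^sub>R x) = r *\<^sub>R bar_free x"
  by (simp_all add: free_linear linear_0 linear_add linear_diff linear_neg linear_scale)

lemma bar_free_bar_free [simp]: "bar_free (bar_free x) = x"
proof (rule endomorphism_eq)
  show "bar_free (bar_free (gen g)) = gen g" for g :: "'a gen"
    by (simp add: gen_sign_def)
qed (auto intro!: linearI simp: bar_free_mult bar_free_1)

lemma delta_free_bar_free: "delta_free (bar_free x) = bar_free (delta_free x)"
proof (rule linear_eq_on_monomials[where x = x])
  fix gs :: "'a gen list"
  have "delta_free 1 = (0 :: 'a free_DW)" using delta_free_mult[of 1 1] by simp
  moreover have "delta_free (bar_free (gen g)) = bar_free (delta_free (gen g))" for g :: "'a gen"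
    by (cases g) (simp_all add: gen_sign_def)
  ultimately show "delta_free (bar_free (monomial gs)) = bar_free (delta_free (monomial gs))"
    by (induction gs) (simp_all add: monomial_def bar_free_1 bar_free_mult delta_free_mult del: bar_free_gen)
qed (auto intro!: linearI)

lemma sigma_free_bar_free: "sigma_free (bar_free x) = bar_free (sigma_free x)"
proof (rule linear_eq_on_monomials[where x = x])
  fix gs :: "'a gen list"
  have "sigma_free 1 = (0 :: 'a free_DW)" using sigma_free_mult[of 1 1] by simp
  moreover have "sigma_free (bar_free (gen g)) = bar_free (sigma_free (gen g))" for g :: "'a gen"
    by (cases g) (simp_all add: gen_sign_def)
  ultimately show "sigma_free (bar_free (monomial gs)) = bar_free (sigma_free (monomial gs))"
    by (induction gs) (simp_all add: monomial_def bar_free_1 bar_free_mult sigma_free_mult del: bar_free_gen)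
qed (auto intro!: linearI)

lemma d_free_bar_free: "d_free (bar_free x) = - bar_free (d_free x)"
proof (rule linear_eq_on_monomials[where x = x])
  fix gs :: "'a gen list"
  have "d_free 1 = (0 :: 'a free_DW)" using d_free_mult[of 1 1] by (simp add: bar_free_1)
  moreover have "d_free (bar_free (gen g)) = - bar_free (d_free (gen g))" for g :: "'a gen"
    by (cases g) (simp_all add: gen_sign_def)
  ultimately show "d_free (bar_free (monomial gs)) = - bar_free (d_free (monomial gs))"
    by (induction gs) (simp_all add: monomial_def bar_free_1 bar_free_mult d_free_mult del: bar_free_gen)
qed (auto intro!: linearI)

lemma delta_free_d_free: "delta_free (d_free x) = d_free (delta_free x)"
proof (rule linear_eq_on_monomials[where x = x])
  fix gs :: "'a gen list"
  have "d_free 1 = (0 :: 'a free_DW)" using d_free_mult[of 1 1] by (simp add: bar_free_1)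
  moreover have "delta_free 1 = (0 :: 'a free_DW)" using delta_free_mult[of 1 1] by simp
  moreover have "delta_free (d_free (gen g)) = d_free (delta_free (gen g))" for g :: "'a gen"
    by (cases g) simp_all
  ultimately show "delta_free (d_free (monomial gs)) = d_free (delta_free (monomial gs))"
    by (induction gs)
       (simp_all add: monomial_def d_free_mult delta_free_mult delta_free_bar_free del: bar_free_gen)
qed (auto intro!: linearI)

lemma sigma_free_d_free: "sigma_free (d_free x) = d_free (sigma_free x)"
proof (rule linear_eq_on_monomials[where x = x])
  fix gs :: "'a gen list"
  have "d_free 1 = (0 :: 'a free_DW)" using d_free_mult[of 1 1] by (simp add: bar_free_1)
  moreover have "sigma_free 1 = (0 :: 'a free_DW)" using sigma_free_mult[of 1 1] by simp
  moreover have "sigma_free (d_free (gen g)) = d_free (sigma_free (gen g))" for g :: "'a gen"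
    by (cases g) simp_all
  ultimately show "sigma_free (d_free (monomial gs)) = d_free (sigma_free (monomial gs))"
    by (induction gs)
       (simp_all add: monomial_def d_free_mult sigma_free_mult sigma_free_bar_free del: bar_free_gen)
qed (auto intro!: linearI)

lemma d_free_d_free [simp]: "d_free (d_free x) = 0"
proof (rule linear_eq_on_monomials[where x = x])
  fix gs :: "'a gen list"
  have "d_free 1 = (0 :: 'a free_DW)" using d_free_mult[of 1 1] by (simp add: bar_free_1)
  moreover have "d_free (d_free (gen g)) = 0" for g :: "'a gen"
    by (cases g) simp_all
  ultimately show "d_free (d_free (monomial gs)) = 0"
    by (induction gs)
       (simp_all add: monomial_def d_free_mult d_free_bar_free del: bar_free_gen)
qed (auto intro!: linearI)

section \<open>Order, weight and the truncating ideal\<close>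

primrec gen_order :: "'q::finite gen \<Rightarrow> nat" where
  "gen_order (Hgen i a) = a"
| "gen_order (Cgen i a) = a"

definition mono_order :: "'q::finite gen list \<Rightarrow> nat"
  where "mono_order gs = sum_list (map gen_order gs)"

text \<open>Truncated subtraction on \<^typ>\<open>nat\<close> renders \<open>max {i - l, 0}\<close>.\<close>

primrec gen_weight :: "'q::finite gen \<Rightarrow> nat" where
  "gen_weight (Hgen i l) = (if l = 0 then 0 else Rep_idx i - l)"
| "gen_weight (Cgen i l) = Rep_idx i - l"

definition mono_weight :: "'q::finite gen list \<Rightarrow> nat"
  where "mono_weight gs = sum_list (map gen_weight gs)"

definition trunc_ideal :: "'q::finite free_DW set"
  where "trunc_ideal = ideal_gen {(delta_free ^^ k) (monomial gs) | k gs. mono_weight gs > CARD('q)}"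

definition weight_ge :: "nat \<Rightarrow> 'q::finite free_DW set"
  where "weight_ge n = span {monomial gs | gs. mono_weight gs \<ge> n}"

lemma subspace_weight_ge: "subspace (weight_ge n)"
  by (simp add: weight_ge_def)

lemma weight_ge_mono: "m \<le> n \<Longrightarrow> weight_ge n \<subseteq> weight_ge m"
  unfolding weight_ge_def by (rule span_mono) auto

lemma weight_ge_gen_mult:
  assumes "v \<in> weight_ge n" "m \<le> gen_weight g + n"
  shows "gen g * v \<in> weight_ge m"
proof -
  have l: "linear (\<lambda>v. gen g * v)" by (rule linearI) (simp_all add: algebra_simps)
  have "gen g * v \<in> (\<lambda>v. gen g * v) ` span {monomial gs | gs. mono_weight gs \<ge> n}"
    using assms(1) by (simp add: weight_ge_def)
  also have "\<dots> = span ((\<lambda>v. gen g * v) ` {monomial gs | gs. mono_weight gs \<ge> n})"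
    by (rule linear_span_image[OF l, symmetric])
  also have "\<dots> \<subseteq> weight_ge m"
  proof (rule span_minimal[OF _ subspace_weight_ge], clarify)
    fix gs :: "'a gen list" assume "n \<le> mono_weight gs"
    then have "m \<le> mono_weight (g # gs)" using assms(2) by (simp add: mono_weight_def)
    moreover have "gen g * monomial gs = monomial (g # gs)" by (simp add: monomial_def)
    ultimately show "gen g * monomial gs \<in> weight_ge m"
      unfolding weight_ge_def by (intro span_base) auto
  qed
  finally show ?thesis .
qed

lemma monomial_weight_ge: "monomial gs \<in> weight_ge (mono_weight gs)"
  unfolding weight_ge_def by (rule span_base) blast

lemma d_free_monomial_weight_ge: "d_free (monomial gs) \<in> weight_ge (mono_weight gs)"
proof (induction gs)
  case Nil
  have "d_free 1 = (0 :: 'a free_DW)" using d_free_mult[of 1 1] by (simp add: bar_free_1)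
  then show ?case by (simp add: monomial_def subspace_0[OF subspace_weight_ge])
next
  case (Cons g gs)
  have "d_free (gen g) * monomial gs \<in> weight_ge (mono_weight (g # gs))"
    by (cases g)
       (auto intro!: weight_ge_gen_mult[OF monomial_weight_ge]
         simp: mono_weight_def subspace_0[OF subspace_weight_ge])
  moreover have "bar_free (gen g) * d_free (monomial gs) \<in> weight_ge (mono_weight (g # gs))"
    using weight_ge_gen_mult[OF Cons.IH, of _ g]
    by (simp add: mono_weight_def subspace_scale[OF subspace_weight_ge])
  ultimately have "d_free (gen g * monomial gs) \<in> weight_ge (mono_weight (g # gs))"
    unfolding d_free_mult by (rule subspace_add[OF subspace_weight_ge])
  then show ?case by (simp add: monomial_def)
qed

lemma sigma_free_monomial_weight_ge: "sigma_free (monomial gs) \<in> weight_ge (mono_weight gs)"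
proof (induction gs)
  case Nil
  have "sigma_free 1 = (0 :: 'a free_DW)" using sigma_free_mult[of 1 1] by simp
  then show ?case by (simp add: monomial_def subspace_0[OF subspace_weight_ge])
next
  case (Cons g gs)
  have w: "gen x * monomial gs \<in> weight_ge (mono_weight (g # gs))"
    if "gen_weight g \<le> gen_weight x" for x
    using that by (intro weight_ge_gen_mult[OF monomial_weight_ge]) (simp add: mono_weight_def)
  have "sigma_free (gen g) * monomial gs \<in> weight_ge (mono_weight (g # gs))"
  proof (cases g)
    case (Hgen i a)
    show ?thesis
    proof (cases "a \<le> 1")
      case True
      then have "a = 0 \<or> a = 1" by auto
      then show ?thesis by (auto simp: Hgen subspace_0[OF subspace_weight_ge])
    next
      case False
      then have "gen (Hgen i (a - 1)) * monomial gs \<in> weight_ge (mono_weight (g # gs))"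
        by (intro w) (simp add: Hgen)
      then show ?thesis by (simp add: Hgen subspace_scale[OF subspace_weight_ge])
    qed
  next
    case (Cgen i a)
    have "gen (Cgen i (a - 1)) * monomial gs \<in> weight_ge (mono_weight (g # gs))"
      by (intro w) (simp add: Cgen)
    then show ?thesis by (simp add: Cgen subspace_scale[OF subspace_weight_ge])
  qed
  moreover have "gen g * sigma_free (monomial gs) \<in> weight_ge (mono_weight (g # gs))"
    using weight_ge_gen_mult[OF Cons.IH, of _ g] by (simp add: mono_weight_def)
  ultimately have "sigma_free (gen g * monomial gs) \<in> weight_ge (mono_weight (g # gs))"
    unfolding sigma_free_mult by (rule subspace_add[OF subspace_weight_ge])
  then show ?case by (simp add: monomial_def)
qed

lemma linear_delta_free_pow: "linear (delta_free ^^ k)"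
proof (induction k)
  case 0
  then show ?case by (simp add: linear_ident id_def)
next
  case (Suc k)
  then show ?case using linear_compose[OF Suc linear_delta_free] by (simp add: o_def)
qed

lemma subspace_trunc_ideal: "subspace trunc_ideal"
  by (simp add: trunc_ideal_def subspace_ideal_gen)

lemma delta_free_pow_trunc_ideal:
  fixes v :: "'q::finite free_DW"
  assumes "v \<in> weight_ge n" "n > CARD('q)"
  shows "(delta_free ^^ k) v \<in> trunc_ideal"
proof -
  have "(delta_free ^^ k) v \<in> (delta_free ^^ k) ` span {monomial gs | gs. mono_weight gs \<ge> n}"
    using assms(1) by (simp add: weight_ge_def)
  also have "\<dots> = span ((delta_free ^^ k) ` {monomial gs | gs. mono_weight gs \<ge> n})"
    by (rule linear_span_image[OF linear_delta_free_pow, symmetric])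
  also have "\<dots> \<subseteq> trunc_ideal"
  proof (rule span_minimal[OF _ subspace_trunc_ideal], clarify)
    fix gs :: "'q gen list" assume "n \<le> mono_weight gs"
    then show "(delta_free ^^ k) (monomial gs) \<in> trunc_ideal"
      unfolding trunc_ideal_def using assms(2) by (intro ideal_gen_superset) force
  qed
  finally show ?thesis .
qed

lemma sigma_delta_free_gen:
  "sigma_free (delta_free (gen g)) = delta_free (sigma_free (gen g)) + real (gen_order g) *\<^sub>R gen g"
proof (cases g)
  case (Hgen i a)
  then show ?thesis
    by (cases a) (simp_all add: algebra_simps flip: scaleR_add_left)
next
  case (Cgen i a)
  then show ?thesis
    by (cases a) (simp_all add: algebra_simps flip: scaleR_add_left)
qed

lemma sigma_delta_free_monomial:
  "sigma_free (delta_free (monomial gs)) = delta_free (sigma_free (monomial gs)) + real (mono_order gs) *\<^sub>R monomial gs"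
proof (induction gs)
  case Nil
  have "sigma_free 1 = (0 :: 'a free_DW)" using sigma_free_mult[of 1 1] by simp
  moreover have "delta_free 1 = (0 :: 'a free_DW)" using delta_free_mult[of 1 1] by simp
  ultimately show ?case by (simp add: monomial_def mono_order_def)
next
  case (Cons g gs)
  have "sigma_free (delta_free (gen g * monomial gs))
     = delta_free (sigma_free (gen g * monomial gs))
       + (real (gen_order g) + real (mono_order gs)) *\<^sub>R (gen g * monomial gs)"
    by (simp add: delta_free_mult sigma_free_mult sigma_delta_free_gen Cons.IH algebra_simps)
  then show ?case by (simp add: monomial_def mono_order_def)
qed

lemma sigma_delta_free_delta:
  "sigma_free (delta_free (delta_free x)) - delta_free (sigma_free (delta_free x))
   - delta_free (sigma_free (delta_free x) - delta_free (sigma_free x)) = delta_free x"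
proof (rule derivation_eq[where b = "\<lambda>x. x" and x = x and g = delta_free and
      f = "\<lambda>x. sigma_free (delta_free (delta_free x)) - delta_free (sigma_free (delta_free x))
        - delta_free (sigma_free (delta_free x) - delta_free (sigma_free x))"])
  fix g :: "'a gen"
  show "sigma_free (delta_free (delta_free (gen g))) - delta_free (sigma_free (delta_free (gen g)))
   - delta_free (sigma_free (delta_free (gen g)) - delta_free (sigma_free (gen g))) = delta_free (gen g)"
  proof (cases g)
    case (Hgen i a)
    show ?thesis
      using sigma_delta_free_gen[of g] sigma_delta_free_gen[of "Hgen i (a + 1)"]
      by (simp add: Hgen algebra_simps del: sigma_free_gen)
  next
    case (Cgen i a)
    show ?thesis
      using sigma_delta_free_gen[of g] sigma_delta_free_gen[of "Cgen i (a + 1)"]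
      by (simp add: Cgen algebra_simps del: sigma_free_gen)
  qed
qed (auto intro!: linearI simp: delta_free_mult sigma_free_mult algebra_simps)

lemma sigma_delta_free_pow:
  "sigma_free (delta_free ((delta_free ^^ k) (monomial gs)))
   = delta_free (sigma_free ((delta_free ^^ k) (monomial gs)))
     + real (mono_order gs + k) *\<^sub>R (delta_free ^^ k) (monomial gs)"
proof (induction k)
  case 0
  then show ?case by (simp add: sigma_delta_free_monomial)
next
  case (Suc k)
  show ?case
    using sigma_delta_free_delta[of "(delta_free ^^ k) (monomial gs)"]
    by (simp add: Suc algebra_simps)
qed

lemma delta_free_trunc_ideal: "x \<in> trunc_ideal \<Longrightarrow> delta_free x \<in> trunc_ideal"
  unfolding trunc_ideal_def
proof (rule ideal_gen_derivation[where e = "\<lambda>x. x", OF linear_delta_free delta_free_mult])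
  fix s :: "'a free_DW"
  let ?S = "{(delta_free ^^ k) (monomial gs) | k gs :: 'a gen list. mono_weight gs > CARD('a)}"
  assume s: "s \<in> ?S"
  then obtain k gs where "s = (delta_free ^^ k) (monomial gs)" "mono_weight gs > CARD('a)" by blast
  then have "delta_free s = (delta_free ^^ Suc k) (monomial gs) \<and> mono_weight gs > CARD('a)" by simp
  then show "delta_free s \<in> ideal_gen ?S" by (intro ideal_gen_superset) blast
  show "s \<in> ideal_gen ?S" by (rule ideal_gen_superset[OF s])
qed simp_all

lemma bar_free_monomial: "bar_free (monomial gs) = prod_list (map (gen_sign (- 1)) gs) *\<^sub>R monomial gs"
  by (induction gs) (simp_all add: monomial_def bar_free_1 bar_free_mult)

lemma bar_free_delta_pow: "bar_free ((delta_free ^^ k) x) = (delta_free ^^ k) (bar_free x)"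
  by (induction k) (simp_all flip: delta_free_bar_free)

lemma d_free_delta_pow: "d_free ((delta_free ^^ k) x) = (delta_free ^^ k) (d_free x)"
  by (induction k) (simp_all flip: delta_free_d_free)

lemma bar_free_trunc_gen:
  assumes "mono_weight gs > CARD('q)"
  shows "bar_free ((delta_free ^^ k) (monomial gs)) \<in> (trunc_ideal :: 'q::finite free_DW set)"
  unfolding bar_free_delta_pow bar_free_monomial
  by (rule delta_free_pow_trunc_ideal[OF subspace_scale[OF subspace_weight_ge monomial_weight_ge] assms])

lemma bar_free_trunc_ideal: "x \<in> trunc_ideal \<Longrightarrow> bar_free x \<in> trunc_ideal"
  unfolding trunc_ideal_def
  by (rule ideal_gen_endo[OF linear_bar_free bar_free_mult])
     (use bar_free_trunc_gen in \<open>auto simp: trunc_ideal_def\<close>)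

lemma d_free_trunc_ideal: "x \<in> trunc_ideal \<Longrightarrow> d_free x \<in> trunc_ideal"
  unfolding trunc_ideal_def
proof (rule ideal_gen_derivation[OF linear_d_free d_free_mult bar_free_mult])
  fix s :: "'a free_DW"
  let ?S = "{(delta_free ^^ k) (monomial gs) | k gs :: 'a gen list. mono_weight gs > CARD('a)}"
  assume "s \<in> ?S"
  then obtain k gs where s: "s = (delta_free ^^ k) (monomial gs)" "mono_weight gs > CARD('a)" by blast
  show "bar_free s \<in> ideal_gen ?S"
    using bar_free_trunc_gen[OF s(2)] by (simp add: s(1) trunc_ideal_def)
  show "d_free s \<in> ideal_gen ?S"
    using delta_free_pow_trunc_ideal[OF d_free_monomial_weight_ge s(2)]
    by (simp add: s(1) d_free_delta_pow trunc_ideal_def)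
qed

lemma sigma_free_trunc_ideal: "x \<in> trunc_ideal \<Longrightarrow> sigma_free x \<in> trunc_ideal"
  unfolding trunc_ideal_def
proof (rule ideal_gen_derivation[where e = "\<lambda>x. x", OF linear_sigma_free sigma_free_mult])
  fix s :: "'a free_DW"
  let ?S = "{(delta_free ^^ k) (monomial gs) | k gs :: 'a gen list. mono_weight gs > CARD('a)}"
  assume sS: "s \<in> ?S"
  then obtain k gs where s: "s = (delta_free ^^ k) (monomial gs)" "mono_weight gs > CARD('a)" by blast
  have "sigma_free ((delta_free ^^ k) (monomial gs)) \<in> trunc_ideal"
  proof (induction k)
    case 0
    then show ?case
      using delta_free_pow_trunc_ideal[OF sigma_free_monomial_weight_ge s(2), of 0] by simp
  next
    case (Suc k)
    have "(delta_free ^^ k) (monomial gs) \<in> trunc_ideal"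
      by (rule delta_free_pow_trunc_ideal[OF monomial_weight_ge s(2)])
    then show ?case
      using delta_free_trunc_ideal[OF Suc]
      by (simp add: sigma_delta_free_pow subspace_add[OF subspace_trunc_ideal]
          subspace_scale[OF subspace_trunc_ideal])
  qed
  then show "sigma_free s \<in> ideal_gen ?S" by (simp add: s(1) trunc_ideal_def)
  show "s \<in> ideal_gen ?S" by (rule ideal_gen_superset[OF sS])
qed simp_all

section \<open>The truncated algebra\<close>

quotient_type (overloaded) 'q DW = "'q::finite free_DW" / "\<lambda>x y. x - y \<in> trunc_ideal"
  by (rule equivp_diff_subspace[OF subspace_trunc_ideal])

instantiation DW :: (finite) "{real_algebra, monoid_mult}"
begin

lift_definition zero_DW :: "'a DW" is 0 .
lift_definition one_DW :: "'a DW" is 1 .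
lift_definition plus_DW :: "'a DW \<Rightarrow> 'a DW \<Rightarrow> 'a DW" is "(+)"
  by (rule subspace_diff_add[OF subspace_trunc_ideal])
lift_definition minus_DW :: "'a DW \<Rightarrow> 'a DW \<Rightarrow> 'a DW" is "(-)"
  by (rule subspace_diff_diff[OF subspace_trunc_ideal])
lift_definition uminus_DW :: "'a DW \<Rightarrow> 'a DW" is uminus
  by (rule subspace_diff_uminus[OF subspace_trunc_ideal])
lift_definition times_DW :: "'a DW \<Rightarrow> 'a DW \<Rightarrow> 'a DW" is "(*)"
  unfolding trunc_ideal_def by (rule diff_mult_mem_ideal_gen)
lift_definition scaleR_DW :: "real \<Rightarrow> 'a DW \<Rightarrow> 'a DW" is "(*\<^sub>R)"
  by (rule subspace_diff_scaleR[OF subspace_trunc_ideal])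

instance
  by standard (transfer, simp add: algebra_simps subspace_0[OF subspace_trunc_ideal])+

end

lift_definition d_DW :: "'q::finite DW \<Rightarrow> 'q DW" is d_free
  using d_free_trunc_ideal by (simp flip: free_simps)
lift_definition delta_DW :: "'q::finite DW \<Rightarrow> 'q DW" is delta_free
  using delta_free_trunc_ideal by (simp flip: free_simps)
lift_definition sigma_DW :: "'q::finite DW \<Rightarrow> 'q DW" is sigma_free
  using sigma_free_trunc_ideal by (simp flip: free_simps)

lift_definition bar_DW :: "'q::finite DW \<Rightarrow> 'q DW" is bar_free
  using bar_free_trunc_ideal by (simp flip: free_simps)

lemma trunc_0 [simp]: "0 \<in> trunc_ideal"
  by (rule subspace_0[OF subspace_trunc_ideal])

lemma linear_DW: "linear d_DW" "linear delta_DW" "linear sigma_DW" "linear bar_DW"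
  by (rule linearI; transfer; simp)+

lemma DW_simps:
  "d_DW (d_DW x) = 0" "bar_DW (bar_DW x) = x" "d_DW (bar_DW x) = - bar_DW (d_DW x)"
  "delta_DW (d_DW x) = d_DW (delta_DW x)" "sigma_DW (d_DW x) = d_DW (sigma_DW x)"
  "d_DW (x * y) = d_DW x * y + bar_DW x * d_DW y"
  "delta_DW (x * y) = delta_DW x * y + x * delta_DW y"
  "sigma_DW (x * y) = sigma_DW x * y + x * sigma_DW y"
  by (transfer; simp add: d_free_bar_free delta_free_d_free sigma_free_d_free
      d_free_mult delta_free_mult sigma_free_mult)+

definition DW_order :: "nat \<Rightarrow> 'q::finite DW set"
  where "DW_order k = abs_DW ` span {monomial gs | gs. mono_order gs = k}"

section \<open>Cohomology\<close>

quotient_type (overloaded) 'q HDW =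
  "'q::finite DW" / partial: "\<lambda>x y. d_DW x = 0 \<and> d_DW y = 0 \<and> x - y \<in> range d_DW"
proof (rule part_equivpI)
  let ?B = "range d_DW :: 'q DW set"
  have B: "subspace ?B" by (rule linear_subspace_image[OF linear_DW(1) subspace_UNIV])
  show "\<exists>x :: 'q DW. d_DW x = 0 \<and> d_DW x = 0 \<and> x - x \<in> ?B"
    by (rule exI[of _ 0]) (simp add: linear_0[OF linear_DW(1)] subspace_0[OF B])
  show "symp (\<lambda>x y. d_DW x = 0 \<and> d_DW y = 0 \<and> x - y \<in> ?B)"
    by (rule sympI, elim conjE, drule subspace_neg[OF B]) simp
  show "transp (\<lambda>x y. d_DW x = 0 \<and> d_DW y = 0 \<and> x - y \<in> ?B)"
    by (rule transpI, elim conjE, drule subspace_add[OF B], assumption) simp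
qed

lemma subspace_range_d_DW: "subspace (range d_DW)"
  by (rule linear_subspace_image[OF linear_DW(1) subspace_UNIV])

lemma DW_linear_simps [simp]:
  "d_DW 0 = 0" "d_DW (x + y) = d_DW x + d_DW y" "d_DW (x - y) = d_DW x - d_DW y"
  "d_DW (- x) = - d_DW x" "d_DW (r *\<^sub>R x) = r *\<^sub>R d_DW x"
  "bar_DW 0 = 0" "delta_DW 0 = 0" "sigma_DW 0 = 0" "0 \<in> range d_DW"
  by (simp_all add: linear_DW linear_0 linear_add linear_diff linear_neg linear_scale
      subspace_0[OF subspace_range_d_DW])

lemma d_DW_1 [simp]: "d_DW (1 :: 'q::finite DW) = 0"
proof -
  have "d_free (1 :: 'q free_DW) = 0" using d_free_mult[of 1 1] by (simp add: bar_free_1)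
  then show ?thesis by transfer simp
qed

lemma bar_DW_cocycle: "d_DW x = 0 \<Longrightarrow> d_DW (bar_DW x) = 0"
  by (simp add: DW_simps)

lemma cohomologous_mult:
  assumes "d_DW x = 0" "d_DW x' = 0" "x - x' \<in> range d_DW"
    and "d_DW y = 0" "d_DW y' = 0" "y - y' \<in> range d_DW"
  shows "x * y - x' * y' \<in> range d_DW"
proof -
  obtain u v where u: "x - x' = d_DW u" and v: "y - y' = d_DW v"
    using assms(3,6) by blast
  have "x * y - x' * y' = (x - x') * y + x' * (y - y')" by (simp add: algebra_simps)
  also have "\<dots> = d_DW (u * y + bar_DW x' * v)"
    using assms by (simp add: u v DW_simps)
  finally show ?thesis by blast
qed

instantiation HDW :: (finite) "{real_algebra, monoid_mult}"
begin

lift_definition zero_HDW :: "'a HDW" is 0 by simp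
lift_definition one_HDW :: "'a HDW" is 1 by simp
lift_definition plus_HDW :: "'a HDW \<Rightarrow> 'a HDW \<Rightarrow> 'a HDW" is "(+)"
  by (simp add: subspace_diff_add[OF subspace_range_d_DW])
lift_definition minus_HDW :: "'a HDW \<Rightarrow> 'a HDW \<Rightarrow> 'a HDW" is "(-)"
  by (simp add: subspace_diff_diff[OF subspace_range_d_DW])
lift_definition uminus_HDW :: "'a HDW \<Rightarrow> 'a HDW" is uminus
  using subspace_diff_uminus[OF subspace_range_d_DW] by auto
lift_definition times_HDW :: "'a HDW \<Rightarrow> 'a HDW \<Rightarrow> 'a HDW" is "(*)"
  by (simp add: cohomologous_mult DW_simps)
lift_definition scaleR_HDW :: "real \<Rightarrow> 'a HDW \<Rightarrow> 'a HDW" is "(*\<^sub>R)"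
  by (simp add: subspace_diff_scaleR[OF subspace_range_d_DW])

instance
  by standard (transfer, simp add: algebra_simps DW_simps)+

end

lift_definition delta_H :: "'q::finite HDW \<Rightarrow> 'q HDW" is delta_DW
  by (auto simp flip: linear_diff[OF linear_DW(2)] DW_simps(4)) (auto simp: DW_simps(4))
lift_definition sigma_H :: "'q::finite HDW \<Rightarrow> 'q HDW" is sigma_DW
  by (auto simp flip: linear_diff[OF linear_DW(3)] DW_simps(5)) (auto simp: DW_simps(5))

lemma linear_delta_H: "linear delta_H"
  by (rule linearI; transfer) (simp_all add: linear_add linear_scale linear_DW DW_simps flip: DW_simps(4))

lemma linear_sigma_H: "linear sigma_H"
  by (rule linearI; transfer) (simp_all add: linear_add linear_scale linear_DW DW_simps flip: DW_simps(5))

lemma delta_H_mult: "delta_H (x * y) = delta_H x * y + x * delta_H y"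
  by transfer (simp add: DW_simps flip: DW_simps(4))

lemma sigma_H_mult: "sigma_H (x * y) = sigma_H x * y + x * sigma_H y"
  by transfer (simp add: DW_simps flip: DW_simps(5))

text \<open>Cohomology classes represented by cocycles of order \<open>k\<close>.\<close>

definition H_order :: "nat \<Rightarrow> 'q::finite HDW set"
  where "H_order k = abs_HDW ` {z \<in> DW_order k. d_DW z = 0}"

definition F_space :: "real \<Rightarrow> nat \<Rightarrow> 'q::finite HDW set"
  where "F_space l k = {x \<in> H_order k. delta_H (sigma_H x) = l *\<^sub>R x}"

definition eigval :: "nat \<Rightarrow> nat \<Rightarrow> real"
  where "eigval m k = 1 / 2 * (real m - 1) * (2 * real k - real m)"

section \<open>Internal direct sums\<close>

definition internal_direct_sum :: "'i set \<Rightarrow> ('i \<Rightarrow> 'v::real_vector set) \<Rightarrow> 'v set \<Rightarrow> bool"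
  where "internal_direct_sum I U V \<longleftrightarrow>
    (\<forall>i\<in>I. subspace (U i)) \<and> V = span (\<Union>i\<in>I. U i) \<and>
    (\<forall>J u. finite J \<and> J \<subseteq> I \<and> (\<forall>i\<in>J. u i \<in> U i) \<and> (\<Sum>i\<in>J. u i) = 0 \<longrightarrow> (\<forall>i\<in>J. u i = 0))"

text \<open>The component in \<open>U i\<close> of \<open>x\<close>, for a finite index set and \<open>x\<close> in the direct sum.\<close>

definition component :: "'i set \<Rightarrow> ('i \<Rightarrow> 'v::real_vector set) \<Rightarrow> 'i \<Rightarrow> 'v \<Rightarrow> 'v"
  where "component I U i x =
    (THE y. \<exists>u. (\<forall>j\<in>I. u j \<in> U j) \<and> x = (\<Sum>j\<in>I. u j) \<and> y = u i)"

definition proj_F :: "nat \<Rightarrow> nat \<Rightarrow> 'q::finite HDW \<Rightarrow> 'q HDW"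
  where "proj_F m k = component {1..k} (\<lambda>m. F_space (eigval m k) k) m"

end

theory Submission
  imports Defs
begin

text \<open>On elements of order \<open>k\<close> the commutator \<open>[\<sigma>, \<delta>]\<close> is multiplication by \<open>k\<close>, and \<open>\<sigma>\<close>
  vanishes in orders \<open>0\<close> and \<open>1\<close>. As in the representation theory of \<open>sl\<^sub>2\<close>, every element of order
  \<open>k \<ge> 1\<close> is a sum of elements \<open>\<delta>\<^sup>m y\<close> with \<open>\<sigma> y = 0\<close>, and these are eigenvectors of \<open>\<delta> \<circ> \<sigma>\<close>.
  The splitting off of the \<open>m = 0\<close> part is explicit: the series \<open>\<Sum>i. c\<^sub>i \<delta>\<^sup>i \<sigma>\<^sup>i\<close> in the theorem
  telescopes to \<open>0\<close> under \<open>\<sigma>\<close> and differs from the identity by an element of the image of \<open>\<delta>\<close>.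
  The orders are independent because they are eigenvalues of the commutator.\<close>

section \<open>Simultaneous eigenvectors and direct sums\<close>

text \<open>Induction on \<open>J\<close>: an operator separating \<open>i\<close> from
  \<open>j\<close> removes \<open>u i\<close> from the relation. A whole family is allowed because
  pairs (eigenvalue, order) are separated only by two operators together.\<close>

lemma simultaneous_eigenvectors_independent:
  fixes u :: "'i \<Rightarrow> 'v::real_vector"
  assumes "finite J"
    and lin: "\<And>a. a \<in> T \<Longrightarrow> linear (A a)"
    and eig: "\<And>a i. a \<in> T \<Longrightarrow> i \<in> J \<Longrightarrow> A a (u i) = c a i *\<^sub>R u i"
    and sep: "\<And>i j. i \<in> J \<Longrightarrow> j \<in> J \<Longrightarrow> i \<noteq> j \<Longrightarrow> \<exists>a\<in>T. c a i \<noteq> c a j"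
    and "(\<Sum>i\<in>J. u i) = 0" "j \<in> J"
  shows "u j = 0"
  using assms(1,3-)
proof (induction J arbitrary: u j rule: finite_induct)
  case (insert i J)
  have J: "u j = 0" if j: "j \<in> J" for j
  proof -
    obtain a where a: "a \<in> T" "c a i \<noteq> c a j"
      using insert.prems(2)[of i j] insert.hyps j by blast
    \<comment> \<open>\<open>v\<close> is the image of \<open>u\<close> under
      \<open>A a - c a i\<close>: it vanishes at \<open>i\<close>, is a nonzero multiple of
      \<open>u j\<close> at \<open>j\<close>, and still satisfies every eigenvalue equation.\<close>
    define v where "v l = (c a l - c a i) *\<^sub>R u l" for l
    have "A a (\<Sum>l\<in>insert i J. u l) - c a i *\<^sub>R (\<Sum>l\<in>insert i J. u l)
        = (\<Sum>l\<in>insert i J. v l)"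
      using insert.prems(1)[OF a(1)]
      by (simp add: linear_sum[OF lin[OF a(1)]] scaleR_sum_right v_def scaleR_diff_left
          flip: sum_subtractf del: sum.insert)
    also have "\<dots> = (\<Sum>l\<in>J. v l)"
      using insert.hyps by (simp add: v_def)
    finally have sum0: "(\<Sum>l\<in>J. v l) = 0"
      unfolding insert.prems(3) by (simp add: linear_0[OF lin[OF a(1)]])
    have "v j = 0"
    proof (rule insert.IH[OF _ _ sum0 j])
      show "A b (v l) = c b l *\<^sub>R v l" if "b \<in> T" "l \<in> J" for b l
        using insert.prems(1)[of b l] that by (simp add: v_def linear_scale[OF lin])
      show "\<exists>b\<in>T. c b l \<noteq> c b l'" if "l \<in> J" "l' \<in> J" "l \<noteq> l'" for l l'
        using insert.prems(2) that by blast
    qed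
    then show ?thesis using a(2) by (simp add: v_def)
  qed
  then have "u i = 0" using insert.prems(3) insert.hyps by simp
  then show ?case using J insert.prems(4) by blast
qed simp

lemma eigenvectors_independent:
  fixes u :: "'i \<Rightarrow> 'v::real_vector"
  assumes "finite J" "linear A" "\<And>i. i \<in> J \<Longrightarrow> A (u i) = c i *\<^sub>R u i" "inj_on c J"
    and "(\<Sum>i\<in>J. u i) = 0" "j \<in> J"
  shows "u j = 0"
  by (rule simultaneous_eigenvectors_independent[where T = "UNIV :: unit set"
        and A = "\<lambda>_. A" and c = "\<lambda>_. c", OF assms(1) _ _ _ assms(5,6)])
     (use assms(2-4) in \<open>auto simp: inj_on_def\<close>)

text \<open>The family takes values in \<open>U i\<close> for every \<open>i\<close> in
  \<open>I\<close> and is zero outside a finite support, so adding a vector with a new index only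
  enlarges that support.\<close>

lemma span_UN_subspaces:
  assumes U: "\<And>i. i \<in> I \<Longrightarrow> subspace (U i)" and x: "x \<in> span (\<Union>i\<in>I. U i)"
  obtains J u where "finite J" "J \<subseteq> I" "\<And>i. i \<in> I \<Longrightarrow> u i \<in> U i"
    "\<And>i. i \<notin> J \<Longrightarrow> u i = 0" "x = (\<Sum>i\<in>J. u i)"
proof -
  have "\<exists>J u. finite J \<and> J \<subseteq> I \<and> (\<forall>i\<in>I. u i \<in> U i) \<and> (\<forall>i. i \<notin> J \<longrightarrow> u i = 0) \<and> x = (\<Sum>i\<in>J. u i)"
    using x
  proof (induction rule: span_induct_alt)
    case base
    show ?case
      by (rule exI[of _ "{}"], rule exI[of _ "\<lambda>_. 0"]) (simp add: subspace_0[OF U])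
  next
    case (step r y x)
    obtain i where i: "i \<in> I" "y \<in> U i" using step by blast
    obtain J u where J: "finite J" "J \<subseteq> I" "\<And>i. i \<in> I \<Longrightarrow> u i \<in> U i"
      "\<And>i. i \<notin> J \<Longrightarrow> u i = 0" "x = (\<Sum>i\<in>J. u i)"
      using step by blast
    let ?w = "\<lambda>l. if l = i then r *\<^sub>R y else 0"
    have "x = (\<Sum>l\<in>insert i J. u l)"
      unfolding J(5) by (rule sum.mono_neutral_left) (use J in auto)
    then have "r *\<^sub>R y + x = (\<Sum>l\<in>insert i J. ?w l + u l)"
      using J(1) by (simp add: sum.distrib del: sum.insert)
    moreover have "\<forall>l\<in>I. ?w l + u l \<in> U l"
      using i J(3) by (auto intro!: subspace_add[OF U] subspace_scale[OF U])
    ultimately show ?case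
      using i(1) J(1,2,4)
      by (intro exI[of _ "insert i J"] exI[of _ "\<lambda>l. ?w l + u l"] conjI) simp_all
  qed
  then show ?thesis by (elim exE conjE) (rule that[rotated 4], assumption, auto)
qed

text \<open>Independence makes the decomposition unique, so the definite description in
  \<open>component\<close> can be evaluated on any given decomposition.\<close>

lemma component_sum:
  assumes "finite I" "internal_direct_sum I U V" "\<And>j. j \<in> I \<Longrightarrow> u j \<in> U j" "i \<in> I"
  shows "component I U i (\<Sum>j\<in>I. u j) = u i"
  unfolding component_def
proof (rule the_equality)
  show "\<exists>v. (\<forall>j\<in>I. v j \<in> U j) \<and> (\<Sum>j\<in>I. u j) = (\<Sum>j\<in>I. v j) \<and> u i = v i"
    using assms(3) by blast
  fix y assume "\<exists>v. (\<forall>j\<in>I. v j \<in> U j) \<and> (\<Sum>j\<in>I. u j) = (\<Sum>j\<in>I. v j) \<and> y = v i"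
  then obtain v where v: "\<And>j. j \<in> I \<Longrightarrow> v j \<in> U j" "(\<Sum>j\<in>I. u j) = (\<Sum>j\<in>I. v j)" "y = v i"
    by blast
  have "\<forall>j\<in>I. u j - v j \<in> U j"
    using assms(2,3) v(1) by (auto simp: internal_direct_sum_def intro!: subspace_diff)
  moreover have "(\<Sum>j\<in>I. u j - v j) = 0"
    by (simp add: sum_subtractf v(2))
  ultimately have "\<forall>j\<in>I. u j - v j = 0"
    using assms(1)
    by (intro assms(2)[unfolded internal_direct_sum_def, THEN conjunct2, THEN conjunct2,
          THEN spec[of _ I], THEN spec, THEN mp] conjI subset_refl)
  then show "y = u i"
    using v(3) assms(4) by auto
qed

lemma linear_funpow:
  fixes f :: "'v::real_vector \<Rightarrow> 'v"
  shows "linear f \<Longrightarrow> linear (f ^^ n)"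
  by (induction n) (simp_all only: funpow.simps linear_id linear_compose)

section \<open>Raising and lowering operators on a graded space\<close>

text \<open>The increment \<open>k\<close> is the scalar by which the commutator of \<sigma> and
  \<delta> acts on order \<open>k\<close>, so \<delta> will raise index and order together.\<close>

lemma eigval_shift: "eigval (Suc m) (Suc k) = eigval m k + real k"
  by (simp add: eigval_def field_simps)

lemma eigval_1 [simp]: "eigval (Suc 0) k = 0"
  by (simp add: eigval_def)

text \<open>As a quadratic in \<open>m\<close> the eigenvalue has its vertex at k + 1/2, so it
  increases strictly on 1, ..., k.\<close>

lemma inj_on_eigval: "inj_on (\<lambda>m. eigval m k) {1..k}"
proof (rule linorder_inj_onI)
  fix m n :: nat assume mn: "m < n" "m \<in> {1..k}" "n \<in> {1..k}"
  have "eigval n k - eigval m k = 1 / 2 * (real n - real m) * (2 * real k + 1 - real n - real m)"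
    by (simp add: eigval_def field_simps)
  also have "\<dots> > 0" using mn by (intro mult_pos_pos) auto
  finally show "eigval m k \<noteq> eigval n k" by simp
qed (rule nat_le_linear)

text \<open>The coefficients of p_{1,k}. The truncated subtractions are exact for k \<ge> 1 and i
  \<le> k - 1, the range of the sum.\<close>

definition ker_coeff :: "nat \<Rightarrow> nat \<Rightarrow> real"
  where "ker_coeff k i = (- 1) ^ i * (2 ^ i * fact (2 * k - i - 2) / (fact (2 * k - 2) * fact i))"

lemma ker_coeff_0 [simp]: "ker_coeff k 0 = 1"
  by (simp add: ker_coeff_def)

text \<open>The recursion that makes the series telescope under \<sigma>. The factor on the left is
  the scalar of \<open>lower_raise_pow\<close> for an element of order k - i - 1.\<close>

lemma ker_coeff_Suc:
  assumes "Suc i < k"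
  shows "ker_coeff k (Suc i) * (real (Suc i) * (2 * real k - real i - 2) / 2) = - ker_coeff k i"
proof -
  \<comment> \<open>\<open>n\<close> is the smaller factorial argument; \<open>Suc i < k\<close>
    makes the truncated subtraction exact.\<close>
  define n where "n = 2 * k - i - 3"
  have n: "2 * k = n + i + 3" using assms by (simp add: n_def)
  have 1: "2 * k - i - 2 = Suc n" and 2: "2 * k - Suc i - 2 = n"
    using n by simp_all
  have "2 * real k = real n + real i + 3"
    using arg_cong[OF n, of real] by simp
  then have 3: "2 * real k - real i - 2 = real (Suc n)" by simp
  show ?thesis
    unfolding ker_coeff_def 1 2 3 by (simp add: divide_simps)
qed

text \<open>The properties of the cohomology on which the argument rests. \<open>lower_V_01\<close>
  reflects the vanishing of a(a - 1)/2 at a = 0 and a = 1.\<close>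

locale raising_lowering =
  fixes \<delta> \<sigma> :: "'v::real_vector \<Rightarrow> 'v" and V :: "nat \<Rightarrow> 'v set"
  assumes linear_raise: "linear \<delta>" and linear_lower: "linear \<sigma>"
    and subspace_V: "subspace (V k)"
    and raise_V: "x \<in> V k \<Longrightarrow> \<delta> x \<in> V (Suc k)"
    and lower_V: "x \<in> V (Suc k) \<Longrightarrow> \<sigma> x \<in> V k"
    and lower_V_01: "x \<in> V k \<Longrightarrow> k \<le> 1 \<Longrightarrow> \<sigma> x = 0"
    and lower_raise: "x \<in> V k \<Longrightarrow> \<sigma> (\<delta> x) = \<delta> (\<sigma> x) + real k *\<^sub>R x"
begin

definition F :: "real \<Rightarrow> nat \<Rightarrow> 'v set"
  where "F l k = {x \<in> V k. \<delta> (\<sigma> x) = l *\<^sub>R x}"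

lemmas raise_simps [simp] = linear_0[OF linear_raise] linear_add[OF linear_raise]
  linear_diff[OF linear_raise] linear_scale[OF linear_raise] linear_sum[OF linear_raise]
lemmas lower_simps [simp] = linear_0[OF linear_lower] linear_add[OF linear_lower]
  linear_diff[OF linear_lower] linear_scale[OF linear_lower] linear_sum[OF linear_lower]

lemma subspace_F: "subspace (F l k)"
proof (rule subspaceI)
  show "0 \<in> F l k" by (simp add: F_def subspace_0[OF subspace_V])
qed (auto simp: F_def scaleR_add_right intro: subspace_add[OF subspace_V] subspace_scale[OF subspace_V])

lemma lower_pow_V: "x \<in> V (k + j) \<Longrightarrow> (\<sigma> ^^ j) x \<in> V k"
  by (induction j arbitrary: x) (simp_all add: lower_V funpow_Suc_right del: funpow.simps(2))

lemma raise_pow_V: "x \<in> V k \<Longrightarrow> (\<delta> ^^ j) x \<in> V (k + j)"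
  by (induction j) (auto simp: raise_V)

lemma lower_pow_eq_0:
  assumes "x \<in> V k" "k \<ge> 1"
  shows "(\<sigma> ^^ k) x = 0"
proof -
  have "(\<sigma> ^^ (k - 1)) x \<in> V 1" using assms by (intro lower_pow_V) simp
  then have "\<sigma> ((\<sigma> ^^ (k - 1)) x) = 0" by (rule lower_V_01) simp
  then show ?thesis using assms(2) by (cases k) auto
qed

section \<open>Sign of the spectrum and motion between eigenspaces\<close>

text \<open>Induction on the order: \<sigma> sends the eigenvalue l in order k + 1 to l - k in order
  k, still negative. Hence \<sigma> x = 0, and l x = \<delta> (\<sigma> x) = 0 with l
  nonzero.\<close>

lemma F_neg_eq_0: "x \<in> F l k \<Longrightarrow> l < 0 \<Longrightarrow> x = 0"
proof (induction k arbitrary: x l)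
  case 0
  then show ?case using lower_V_01[of x 0] by (simp add: F_def)
next
  case (Suc k)
  have x: "x \<in> V (Suc k)" "\<delta> (\<sigma> x) = l *\<^sub>R x" using Suc.prems(1) by (auto simp: F_def)
  have "\<delta> (\<sigma> (\<sigma> x)) = (l - real k) *\<^sub>R \<sigma> x"
    using lower_raise[OF lower_V[OF x(1)]] by (simp add: x(2) scaleR_diff_left)
  then have "\<sigma> x \<in> F (l - real k) k"
    using lower_V[OF x(1)] by (simp add: F_def)
  then have "\<sigma> x = 0" by (rule Suc.IH) (use Suc.prems(2) in simp)
  then show ?case using x(2) Suc.prems(2) by simp
qed

text \<open>If \<delta> x = 0, the commutation relation gives x the negative eigenvalue -k.\<close>

lemma raise_eq_0D: "x \<in> V k \<Longrightarrow> k \<ge> 1 \<Longrightarrow> \<delta> x = 0 \<Longrightarrow> x = 0"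
  using lower_raise[of x k]
  by (intro F_neg_eq_0[of x "- real k" k]) (auto simp: F_def eq_neg_iff_add_eq_0)

text \<open>For k \<ge> 2, \<delta> is injective on order k - 1 \<ge> 1, so \<delta> (\<sigma> x) =
  0 forces \<sigma> x = 0; for k \<le> 1, \<sigma> vanishes anyway.\<close>

lemma F_0_iff: "x \<in> F 0 k \<longleftrightarrow> x \<in> V k \<and> \<sigma> x = 0"
proof (cases "k \<le> 1")
  case True
  then show ?thesis using lower_V_01[of x k] by (auto simp: F_def)
next
  case False
  then obtain n where k: "k = Suc n" "n \<ge> 1" by (cases k) auto
  show ?thesis using raise_eq_0D[OF lower_V k(2)] by (auto simp: F_def k(1))
qed

lemma raise_F:
  assumes "x \<in> F (eigval m k) k"
  shows "\<delta> x \<in> F (eigval (Suc m) (Suc k)) (Suc k)"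
proof -
  have x: "x \<in> V k" "\<delta> (\<sigma> x) = eigval m k *\<^sub>R x" using assms by (auto simp: F_def)
  have "\<sigma> (\<delta> x) = eigval (Suc m) (Suc k) *\<^sub>R x"
    unfolding lower_raise[OF x(1)] x(2) eigval_shift scaleR_add_left ..
  then show ?thesis by (simp add: F_def raise_V[OF x(1)])
qed

lemma lower_F:
  assumes "x \<in> F (eigval (Suc m) (Suc k)) (Suc k)"
  shows "\<sigma> x \<in> F (eigval m k) k"
proof -
  have x: "x \<in> V (Suc k)" "\<delta> (\<sigma> x) = (eigval m k + real k) *\<^sub>R x"
    using assms by (auto simp: F_def eigval_shift)
  have "\<delta> (\<sigma> (\<sigma> x)) = eigval m k *\<^sub>R \<sigma> x"
    using lower_raise[OF lower_V[OF x(1)]] unfolding x(2) by (simp add: scaleR_add_left)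
  then show ?thesis by (simp add: F_def lower_V[OF x(1)])
qed

lemma lower_pow_F: "x \<in> F (eigval (m + j) (k + j)) (k + j) \<Longrightarrow> (\<sigma> ^^ j) x \<in> F (eigval m k) k"
  by (induction j arbitrary: x)
     (auto simp del: funpow.simps(2) simp: funpow_Suc_right intro: lower_F)

text \<open>After m - 1 steps the index has dropped to 1, where the eigenvalue is 0 and \<sigma>
  vanishes by \<open>F_0_iff\<close>.\<close>

lemma lower_pow_F_eq_0:
  assumes "x \<in> F (eigval m k) k" "1 \<le> m" "m \<le> j" "m \<le> k"
  shows "(\<sigma> ^^ j) x = 0"
proof -
  have "(\<sigma> ^^ (m - 1)) x \<in> F (eigval 1 (k - (m - 1))) (k - (m - 1))"
    using assms by (intro lower_pow_F) simp
  then have "\<sigma> ((\<sigma> ^^ (m - 1)) x) = 0" by (simp add: F_0_iff)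
  then have "(\<sigma> ^^ m) x = 0" using assms(2) by (cases m) auto
  moreover have "(\<sigma> ^^ j) x = (\<sigma> ^^ (j - m)) ((\<sigma> ^^ m) x)"
    using assms(3) by (simp flip: funpow_add[THEN fun_cong, simplified])
  ultimately show ?thesis by (simp add: linear_0[OF linear_funpow[OF linear_lower]])
qed

section \<open>The explicit projection onto the kernel of \<sigma>\<close>

text \<open>Moving \<sigma> past i + 1 copies of \<delta> collects the orders k, k + 1, ..., k + i,
  whose sum is (i + 1)(2k + i)/2.\<close>

lemma lower_raise_pow:
  assumes "x \<in> V k"
  shows "\<sigma> ((\<delta> ^^ Suc i) x)
    = (\<delta> ^^ Suc i) (\<sigma> x) + (real (Suc i) * (2 * real k + real i) / 2) *\<^sub>R (\<delta> ^^ i) x"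
proof (induction i)
  case 0
  then show ?case using lower_raise[OF assms] by simp
next
  case (Suc i)
  have "\<sigma> (\<delta> ((\<delta> ^^ Suc i) x)) = \<delta> (\<sigma> ((\<delta> ^^ Suc i) x)) + real (k + Suc i) *\<^sub>R (\<delta> ^^ Suc i) x"
    by (rule lower_raise[OF raise_pow_V[OF assms]])
  also have "\<dots> = \<delta> ((\<delta> ^^ Suc i) (\<sigma> x)) + (real (Suc i) * (2 * real k + real i) / 2 + real (k + Suc i))
      *\<^sub>R (\<delta> ^^ Suc i) x"
    unfolding Suc linear_add[OF linear_raise] linear_scale[OF linear_raise] scaleR_add_left
    by (simp only: funpow.simps o_apply add.assoc)
  also have "real (Suc i) * (2 * real k + real i) / 2 + real (k + Suc i)
      = real (Suc (Suc i)) * (2 * real k + real (Suc i)) / 2"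
    by (simp add: field_simps)
  finally show ?case by (simp only: funpow.simps o_apply)
qed

text \<open>The claimed formula for p_{1,k}, taken as an operator in its own right;
  \<open>proj_1\<close> identifies it with the projector.\<close>

definition ker_proj :: "nat \<Rightarrow> 'v \<Rightarrow> 'v"
  where "ker_proj k x = (\<Sum>i = 0..k - 1. ker_coeff k i *\<^sub>R (\<delta> ^^ i) ((\<sigma> ^^ i) x))"

lemma raise_lower_pow_V:
  assumes "x \<in> V k" "i \<le> k"
  shows "(\<delta> ^^ i) ((\<sigma> ^^ i) x) \<in> V k"
  using raise_pow_V[OF lower_pow_V[of x "k - i" i], of i] assms by simp

text \<open>By \<open>ker_coeff_Suc\<close>, \<sigma> turns each term with i \<ge> 1 into a
  difference of consecutive \<open>?t\<close>. The sum collapses to the last one, which contains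
  \<sigma>^k x = 0.\<close>

lemma lower_ker_proj:
  assumes x: "x \<in> V k" and k: "k \<ge> 1"
  shows "\<sigma> (ker_proj k x) = 0"
proof -
  let ?t = "\<lambda>i. ker_coeff k i *\<^sub>R (\<delta> ^^ i) ((\<sigma> ^^ Suc i) x)"
  have step: "\<sigma> (ker_coeff k (Suc i) *\<^sub>R (\<delta> ^^ Suc i) ((\<sigma> ^^ Suc i) x)) = ?t (Suc i) - ?t i"
    if i: "Suc i < k" for i
  proof -
    have "(\<sigma> ^^ Suc i) x \<in> V (k - Suc i)" using x i by (intro lower_pow_V) simp
    from lower_raise_pow[OF this, of i]
    have "\<sigma> (ker_coeff k (Suc i) *\<^sub>R (\<delta> ^^ Suc i) ((\<sigma> ^^ Suc i) x))
      = ?t (Suc i) + (ker_coeff k (Suc i) * (real (Suc i) * (2 * real (k - Suc i) + real i) / 2))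
          *\<^sub>R (\<delta> ^^ i) ((\<sigma> ^^ Suc i) x)"
      by (simp add: scaleR_add_right del: of_nat_Suc)
    also have "2 * real (k - Suc i) + real i = 2 * real k - real i - 2"
      using i by (simp add: of_nat_diff)
    finally show ?thesis by (simp only: ker_coeff_Suc[OF i]) simp
  qed
  have "\<sigma> (\<Sum>i = 0..n. ker_coeff k i *\<^sub>R (\<delta> ^^ i) ((\<sigma> ^^ i) x)) = ?t n" if "n < k" for n
    using that
  proof (induction n)
    case (Suc n)
    then show ?case using step[of n] by (simp del: funpow.simps lower_simps add: linear_add[OF linear_lower])
  qed simp
  from this[of "k - 1"] have "\<sigma> (ker_proj k x) = ?t (k - 1)" using k by (simp add: ker_proj_def)
  also have "\<dots> = 0"
    using lower_pow_eq_0[OF x k] k by (simp add: linear_0[OF linear_funpow[OF linear_raise]])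
  finally show ?thesis .
qed

lemma ker_proj_F:
  assumes "x \<in> V k" "k \<ge> 1"
  shows "ker_proj k x \<in> F 0 k"
  unfolding F_0_iff
proof
  show "ker_proj k x \<in> V k"
    unfolding ker_proj_def using assms
    by (intro subspace_sum[OF subspace_V] subspace_scale[OF subspace_V] raise_lower_pow_V) auto
qed (rule lower_ker_proj[OF assms])

text \<open>The term i = 0 of the series is x itself and every later term begins with \<delta>;
  factoring that \<delta> out gives \<open>y\<close>.\<close>

lemma ker_proj_complement:
  assumes x: "x \<in> V (Suc k)"
  obtains y where "y \<in> V k" "x = ker_proj (Suc k) x + \<delta> y"
proof
  let ?y = "\<Sum>i<k. (- ker_coeff (Suc k) (Suc i)) *\<^sub>R (\<delta> ^^ i) ((\<sigma> ^^ Suc i) x)"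
  show "?y \<in> V k"
  proof (intro subspace_sum[OF subspace_V] subspace_scale[OF subspace_V])
    fix i assume "i \<in> {..<k}"
    then show "(\<delta> ^^ i) ((\<sigma> ^^ Suc i) x) \<in> V k"
      using raise_lower_pow_V[OF lower_V[OF x], of i] by (simp add: funpow_swap1)
  qed
  have "ker_proj (Suc k) x = x - \<delta> ?y"
    by (simp add: ker_proj_def sum.atLeast0_atMost_Suc_shift sum_negf atLeast0AtMost
        sum.atMost_shift linear_neg[OF linear_raise])
  then show "x = ker_proj (Suc k) x + \<delta> ?y" by simp
qed

section \<open>Decomposition of each order into eigenspaces\<close>

text \<open>Induction on the order: split off the kernel part and apply \<delta> to the
  decomposition of the remainder \<open>y\<close>, which raises each index by one. The clause on
  \<open>u 1\<close> serves to compute the first projector.\<close>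

lemma eigen_decomposition:
  assumes "x \<in> V (Suc k)"
  shows "\<exists>u. (\<forall>m\<in>{1..Suc k}. u m \<in> F (eigval m (Suc k)) (Suc k)) \<and>
    x = (\<Sum>m\<in>{1..Suc k}. u m) \<and> u 1 = ker_proj (Suc k) x"
  using assms
proof (induction k arbitrary: x)
  case 0
  then show ?case
    \<comment> \<open>In order 1 the series has only the term i = 0, so \<open>ker_proj\<close> is
      the identity.\<close>
    using ker_proj_F[OF 0] by (intro exI[of _ "\<lambda>_. x"]) (simp_all add: ker_proj_def)
next
  case (Suc k)
  obtain y where y: "y \<in> V (Suc k)" "x = ker_proj (Suc (Suc k)) x + \<delta> y"
    using ker_proj_complement[OF Suc.prems] by blast
  obtain v where v: "\<And>m. m \<in> {1..Suc k} \<Longrightarrow> v m \<in> F (eigval m (Suc k)) (Suc k)"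
    "y = (\<Sum>m\<in>{1..Suc k}. v m)"
    using Suc.IH[OF y(1)] by blast
  let ?u = "\<lambda>m. if m = 1 then ker_proj (Suc (Suc k)) x else \<delta> (v (m - 1))"
  have "\<delta> y = (\<Sum>m\<in>{1..Suc k}. ?u (Suc m))"
    unfolding v(2) by simp
  also have "\<dots> = (\<Sum>m\<in>{Suc 1..Suc (Suc k)}. ?u m)"
    by (rule sum.shift_bounds_cl_Suc_ivl[symmetric])
  finally have "x = (\<Sum>m\<in>{1..Suc (Suc k)}. ?u m)"
    using y(2) by (subst sum.atLeast_Suc_atMost) simp_all
  moreover have "?u m \<in> F (eigval m (Suc (Suc k))) (Suc (Suc k))" if m: "m \<in> {1..Suc (Suc k)}" for m
  proof (cases "m = 1")
    case True
    then show ?thesis using ker_proj_F[OF Suc.prems] by simp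
  next
    case False
    then obtain n where "m = Suc n" "n \<in> {1..Suc k}" using m by (cases m) auto
    then show ?thesis using raise_F[OF v(1)] by auto
  qed
  ultimately show ?case by (intro exI[of _ ?u]) auto
qed

lemma linear_raise_lower: "linear (\<lambda>x. \<delta> (\<sigma> x))"
  by (rule linear_comp'[OF linear_raise linear_lower])

lemma direct_sum_V:
  assumes "k \<ge> 1"
  shows "internal_direct_sum {1..k} (\<lambda>m. F (eigval m k) k) (V k)"
  unfolding internal_direct_sum_def
proof (intro conjI allI impI ballI)
  show "V k = span (\<Union>m\<in>{1..k}. F (eigval m k) k)"
  proof
    show "span (\<Union>m\<in>{1..k}. F (eigval m k) k) \<subseteq> V k"
      by (rule span_minimal[OF _ subspace_V]) (auto simp: F_def)
    obtain n where k: "k = Suc n" using assms by (cases k) auto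
    show "V k \<subseteq> span (\<Union>m\<in>{1..k}. F (eigval m k) k)"
      using eigen_decomposition unfolding k by (blast intro: span_sum span_base)
  qed
  fix J :: "nat set" and u m
  assume J: "finite J \<and> J \<subseteq> {1..k} \<and> (\<forall>m\<in>J. u m \<in> F (eigval m k) k) \<and> (\<Sum>m\<in>J. u m) = 0"
    and m: "m \<in> J"
  show "u m = 0"
    by (rule eigenvectors_independent[where c = "\<lambda>m. eigval m k", OF _ linear_raise_lower _ _ _ m])
       (use J inj_on_subset[OF inj_on_eigval] in \<open>auto simp: F_def\<close>)
qed (rule subspace_F)

section \<open>Formulas for the projectors\<close>

abbreviation proj :: "nat \<Rightarrow> nat \<Rightarrow> 'v \<Rightarrow> 'v"
  where "proj m k \<equiv> component {1..k} (\<lambda>m. F (eigval m k) k) m"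

lemma proj_sum:
  assumes "\<And>j. j \<in> {1..k} \<Longrightarrow> u j \<in> F (eigval j k) k" "m \<in> {1..k}"
  shows "proj m k (\<Sum>j\<in>{1..k}. u j) = u m"
  by (rule component_sum[OF _ direct_sum_V _ assms(2)]) (use assms in auto)

lemma proj_1:
  assumes "x \<in> V k" "k \<ge> 1"
  shows "proj 1 k x = ker_proj k x"
proof -
  obtain n where k: "k = Suc n" using assms by (cases k) auto
  obtain u where u: "\<And>m. m \<in> {1..k} \<Longrightarrow> u m \<in> F (eigval m k) k" "x = (\<Sum>m\<in>{1..k}. u m)"
    "u 1 = ker_proj k x"
    using eigen_decomposition assms(1) unfolding k by blast
  have "proj 1 k x = u 1"
    unfolding u(2) by (rule proj_sum[OF u(1)]) (use assms in auto)
  then show ?thesis unfolding u(3) .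
qed

text \<open>Here \<delta>^j \<sigma>^j multiplies by the product of the eigenvalues i(2a + 1 + i)/2
  for i = 1, ..., j; the identity is stated with denominators cleared.\<close>

lemma raise_lower_pow_F:
  assumes "x \<in> F (eigval (Suc j) (a + Suc j)) (a + Suc j)"
  shows "(2 ^ j * fact (2 * a + 1)) *\<^sub>R (\<delta> ^^ j) ((\<sigma> ^^ j) x)
    = (fact j * fact (2 * a + 1 + j)) *\<^sub>R x"
  using assms
proof (induction j arbitrary: x)
  case (Suc j)
  have "\<sigma> x \<in> F (eigval (Suc j) (a + Suc j)) (a + Suc j)"
    using Suc.prems lower_F by simp
  then have "(2 ^ j * fact (2 * a + 1)) *\<^sub>R (\<delta> ^^ j) ((\<sigma> ^^ j) (\<sigma> x))
      = (fact j * fact (2 * a + 1 + j)) *\<^sub>R \<sigma> x"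
    by (rule Suc.IH)
  then have IH: "\<delta> ((2 ^ j * fact (2 * a + 1)) *\<^sub>R (\<delta> ^^ j) ((\<sigma> ^^ j) (\<sigma> x)))
      = \<delta> ((fact j * fact (2 * a + 1 + j)) *\<^sub>R \<sigma> x)"
    by (rule arg_cong)
  have eig: "\<delta> (\<sigma> x) = (real (Suc j) * real (2 * a + 2 + j) / 2) *\<^sub>R x"
    using Suc.prems by (simp add: F_def eigval_def)
  have "(2 ^ Suc j * fact (2 * a + 1)) *\<^sub>R (\<delta> ^^ Suc j) ((\<sigma> ^^ Suc j) x)
      = 2 *\<^sub>R (2 ^ j * fact (2 * a + 1)) *\<^sub>R \<delta> ((\<delta> ^^ j) ((\<sigma> ^^ j) (\<sigma> x)))"
    by (simp add: funpow_swap1 mult.assoc)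
  also have "\<dots> = (2 * (fact j * fact (2 * a + 1 + j))) *\<^sub>R \<delta> (\<sigma> x)"
    using IH by (simp only: linear_scale[OF linear_raise] scaleR_scaleR mult.assoc)
  also have "\<dots> = (2 * (fact j * fact (2 * a + 1 + j)) * (real (Suc j) * real (2 * a + 2 + j) / 2)) *\<^sub>R x"
    unfolding eig scaleR_scaleR ..
  also have "2 * (fact j * fact (2 * a + 1 + j)) * (real (Suc j) * real (2 * a + 2 + j) / 2)
      = fact (Suc j) * fact (Suc (2 * a + 1 + j))"
    by (simp only: fact_Suc of_nat_mult) simp
  finally show ?case by simp
qed simp

text \<open>With j = k - a - 1, \<sigma>^j kills the components of index at most j and brings the
  one of index j + 1 = k - a to index 1 in order a + 1, where p_{1,a+1} selects it. Then \<delta>^j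
  restores it up to the scalar of \<open>raise_lower_pow_F\<close>.\<close>

lemma proj_formula:
  assumes x: "x \<in> V k" and a: "a < k"
  shows "proj (k - a) k x = (2 ^ (k - a - 1) * fact (2 * a + 1) / (fact (k - a - 1) * fact (k + a)))
    *\<^sub>R (\<delta> ^^ (k - a - 1)) (proj 1 (a + 1) ((\<sigma> ^^ (k - a - 1)) x))"
proof -
  define j where "j = k - a - 1"
  have k: "k = a + Suc j" using a by (simp add: j_def)
  obtain u where u: "\<And>m. m \<in> {1..k} \<Longrightarrow> u m \<in> F (eigval m k) k" "x = (\<Sum>m\<in>{1..k}. u m)"
    using eigen_decomposition x unfolding k by force
  let ?w = "\<lambda>m. (\<sigma> ^^ j) (u (m + j))"
  have "(\<sigma> ^^ j) x = (\<Sum>m\<in>{1..k}. (\<sigma> ^^ j) (u m))"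
    unfolding u(2) by (rule linear_sum[OF linear_funpow[OF linear_lower]])
  also have "\<dots> = (\<Sum>m\<in>{1 + j..a + 1 + j}. (\<sigma> ^^ j) (u m))"
  proof (rule sum.mono_neutral_right)
    show "\<forall>m\<in>{1..k} - {1 + j..a + 1 + j}. (\<sigma> ^^ j) (u m) = 0"
      using lower_pow_F_eq_0[OF u(1)] by (auto simp: k)
  qed (auto simp: k)
  also have "\<dots> = (\<Sum>m\<in>{1..a + 1}. ?w m)"
    by (rule sum.shift_bounds_cl_nat_ivl)
  finally have s: "(\<sigma> ^^ j) x = (\<Sum>m\<in>{1..a + 1}. ?w m)" .
  have "proj 1 (a + 1) ((\<sigma> ^^ j) x) = ?w 1"
    unfolding s
  proof (rule proj_sum)
    fix m assume "m \<in> {1..a + 1}"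
    then show "?w m \<in> F (eigval m (a + 1)) (a + 1)"
      using u(1)[of "m + j"] by (intro lower_pow_F) (auto simp: k)
  qed simp
  moreover have "(2 ^ j * fact (2 * a + 1)) *\<^sub>R (\<delta> ^^ j) ((\<sigma> ^^ j) (u (Suc j)))
    = (fact j * fact (2 * a + 1 + j)) *\<^sub>R u (Suc j)"
  proof (rule raise_lower_pow_F)
    show "u (Suc j) \<in> F (eigval (Suc j) (a + Suc j)) (a + Suc j)"
      using u(1)[of "Suc j"] by (simp add: k)
  qed
  then have "(2 ^ j * fact (2 * a + 1) / (fact j * fact (2 * a + 1 + j))) *\<^sub>R (\<delta> ^^ j) ((\<sigma> ^^ j) (u (Suc j)))
    = u (Suc j)"
    by (simp only: vector_fraction_eq_iff mult_eq_0_iff fact_nonzero simp_thms if_False)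
  moreover have "proj (Suc j) k x = u (Suc j)"
    unfolding u(2) by (rule proj_sum[OF u(1)]) (auto simp: k)
  moreover have "k - a = Suc j" "k - a - 1 = j" "k + a = 2 * a + 1 + j"
    by (auto simp: k)
  ultimately show ?thesis by (simp only: plus_1_eq_Suc)
qed

section \<open>Independence across orders and injectivity\<close>

lemma commutator_V: "x \<in> V k \<Longrightarrow> \<sigma> (\<delta> x) - \<delta> (\<sigma> x) = real k *\<^sub>R x"
  by (simp add: lower_raise)

lemma linear_commutator: "linear (\<lambda>x. \<sigma> (\<delta> x) - \<delta> (\<sigma> x))"
  by (intro linear_compose_sub linear_comp'[OF linear_raise linear_lower]
      linear_comp'[OF linear_lower linear_raise])

lemma V_independent:
  assumes "finite J" "\<And>k. k \<in> J \<Longrightarrow> u k \<in> V k" "(\<Sum>k\<in>J. u k) = 0" "k \<in> J"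
  shows "u k = 0"
  by (rule eigenvectors_independent[OF assms(1) linear_commutator commutator_V[OF assms(2)] _ assms(3,4)])
     (auto simp: inj_on_def)

lemma F_independent:
  assumes J: "finite J" "\<And>n k. (n, k) \<in> J \<Longrightarrow> u (n, k) \<in> F (of_int n) k"
    and "(\<Sum>p\<in>J. u p) = 0" "p \<in> J"
  shows "u p = 0"
\<comment> \<open>\<open>True\<close> indexes \<delta> \<circ> \<sigma>, which detects
  \<open>n\<close>, and \<open>False\<close> the commutator, which detects \<open>k\<close>;
  distinct pairs differ under one of them.\<close>
proof (rule simultaneous_eigenvectors_independent[where T = UNIV
      and A = "\<lambda>b. if b then (\<lambda>x. \<delta> (\<sigma> x)) else (\<lambda>x. \<sigma> (\<delta> x) - \<delta> (\<sigma> x))"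
      and c = "\<lambda>b (n, k). if b then of_int n else real k", OF J(1) _ _ _ assms(3,4)])
  fix b and p :: "int \<times> nat" assume p: "p \<in> J"
  obtain n k where nk: "p = (n, k)" by (cases p)
  show "(if b then (\<lambda>x. \<delta> (\<sigma> x)) else (\<lambda>x. \<sigma> (\<delta> x) - \<delta> (\<sigma> x))) (u p)
      = (\<lambda>(n, k). if b then of_int n else real k) p *\<^sub>R u p"
    using J(2)[of n k] p commutator_V[of "u p" k] by (auto simp: nk F_def)
qed (auto simp: linear_raise_lower linear_commutator ex_bool_eq)

lemma direct_sum_F:
  fixes I :: "(int \<times> nat) set"
  shows "internal_direct_sum I (\<lambda>(n, k). F (of_int n) k) (span (\<Union>(n, k)\<in>I. F (of_int n) k))"
  unfolding internal_direct_sum_def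
proof (intro conjI allI impI ballI)
  show "subspace (case p of (n, k) \<Rightarrow> F (of_int n) k)" for p :: "int \<times> nat"
    by (simp add: subspace_F split: prod.split)
  fix J u p
  assume "finite J \<and> J \<subseteq> I \<and> (\<forall>p\<in>J. u p \<in> (case p of (n, k) \<Rightarrow> F (of_int n) k)) \<and> (\<Sum>p\<in>J. u p) = 0"
    and "p \<in> J"
  then show "u p = 0" by (intro F_independent[of J u p]) auto
qed simp

lemma direct_sum_all_V: "internal_direct_sum I V (span (\<Union>k\<in>I. V k))"
  unfolding internal_direct_sum_def using V_independent by (auto simp: subspace_V)

text \<open>Applying \<delta> to \<sigma> x = 0 multiplies each component by its eigenvalue. By
  independence every product is zero, and the eigenvalues are nonzero.\<close>

lemma inj_on_lower:
  fixes I :: "(int \<times> nat) set"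
  assumes I: "\<And>n k. (n, k) \<in> I \<Longrightarrow> n \<noteq> 0"
  shows "inj_on \<sigma> (span (\<Union>(n, k)\<in>I. F (of_int n) k))"
proof (subst linear_inj_on_iff_eq_0[OF linear_lower subspace_span], intro ballI impI)
  fix x assume x: "x \<in> span (\<Union>(n, k)\<in>I. F (of_int n) k)" "\<sigma> x = 0"
  obtain J u where J: "finite J" "J \<subseteq> I" "\<And>p. p \<in> I \<Longrightarrow> u p \<in> (case p of (n, k) \<Rightarrow> F (of_int n) k)"
    "x = (\<Sum>p\<in>J. u p)"
    by (rule span_UN_subspaces[OF _ x(1)]) (auto simp: subspace_F)
  have u: "u (n, k) \<in> F (of_int n) k" if "(n, k) \<in> J" for n k
    using J(3)[of "(n, k)"] J(2) that by auto
  have "0 = \<delta> (\<sigma> x)" by (simp add: x(2))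
  also have "\<dots> = (\<Sum>p\<in>J. of_int (fst p) *\<^sub>R u p)"
    unfolding J(4) using u by (auto simp: F_def intro!: sum.cong)
  finally have s: "(\<Sum>p\<in>J. of_int (fst p) *\<^sub>R u p) = 0" by simp
  have "of_int (fst p) *\<^sub>R u p = 0" if "p \<in> J" for p
    by (rule F_independent[OF J(1) _ s that]) (auto intro!: subspace_scale[OF subspace_F] u)
  then have "u p = 0" if "p \<in> J" for p
    using that I J(2) by (cases p) force
  then show "x = 0" by (simp add: J(4))
qed

text \<open>Since \<sigma> \<circ> \<delta> preserves the order, \<sigma> (\<delta> x) = 0 holds
  component by component. Each component of order k then has eigenvalue -k, so
  \<open>F_neg_eq_0\<close> applies.\<close>

lemma inj_on_raise: "inj_on \<delta> (span (\<Union>k\<in>{k. k \<ge> 1}. V k))"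
proof (subst linear_inj_on_iff_eq_0[OF linear_raise subspace_span], intro ballI impI)
  fix x assume x: "x \<in> span (\<Union>k\<in>{k. k \<ge> 1}. V k)" "\<delta> x = 0"
  obtain J u where J: "finite J" "J \<subseteq> {k. k \<ge> 1}" "\<And>k. k \<in> {k. k \<ge> 1} \<Longrightarrow> u k \<in> V k" "x = (\<Sum>k\<in>J. u k)"
    by (rule span_UN_subspaces[OF _ x(1)]) (auto simp: subspace_V)
  have s: "(\<Sum>k\<in>J. \<sigma> (\<delta> (u k))) = 0"
    using x(2) by (simp add: J(4) flip: linear_sum[OF linear_lower])
  have V: "\<sigma> (\<delta> (u k)) \<in> V k" if "k \<in> J" for k
    using J that by (intro lower_V raise_V) auto
  have "u k = 0" if k: "k \<in> J" for k
  proof -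
    have "\<sigma> (\<delta> (u k)) = 0" by (rule V_independent[OF J(1) V s k])
    then have "u k \<in> F (- real k) k"
      using lower_raise[of "u k" k] J k by (auto simp: F_def eq_neg_iff_add_eq_0)
    then show ?thesis using F_neg_eq_0 J(2) k by force
  qed
  then show "x = 0" by (simp add: J(4))
qed

end

section \<open>The order grading of the cohomology\<close>

definition order_free :: "nat \<Rightarrow> 'q::finite free_DW set"
  where "order_free k = span {monomial gs | gs. mono_order gs = k}"

lemma subspace_order_free: "subspace (order_free k)"
  by (simp add: order_free_def)

lemma order_free_linear:
  assumes "linear f" "subspace W" "x \<in> order_free k" "\<And>gs. mono_order gs = k \<Longrightarrow> f (monomial gs) \<in> W"
  shows "f x \<in> W"
proof -
  have "f x \<in> span (f ` {monomial gs | gs. mono_order gs = k})"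
    using assms(3) by (simp add: order_free_def linear_span_image[OF assms(1)])
  also have "\<dots> \<subseteq> W" using assms(2,4) by (intro span_minimal) auto
  finally show ?thesis .
qed

lemma monomial_order_free: "mono_order gs = k \<Longrightarrow> monomial gs \<in> order_free k"
  unfolding order_free_def by (intro span_base) blast

lemma gen_mult_order_free:
  assumes "x \<in> order_free k"
  shows "gen g * x \<in> order_free (gen_order g + k)"
proof (rule order_free_linear[OF _ subspace_order_free assms])
  show "linear (\<lambda>x. gen g * x)" by (auto intro!: linearI simp: algebra_simps)
  fix gs :: "'a gen list" assume "mono_order gs = k"
  then have "monomial (g # gs) \<in> order_free (gen_order g + k)"
    by (intro monomial_order_free) (simp add: mono_order_def)
  then show "gen g * monomial gs \<in> order_free (gen_order g + k)" by (simp add: monomial_def)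
qed

lemma derivation_1_eq_0: "delta_free (1 :: 'q::finite free_DW) = 0" "sigma_free (1 :: 'q free_DW) = 0"
  using delta_free_mult[of 1 "1 :: 'q free_DW"] sigma_free_mult[of 1 "1 :: 'q free_DW"] by simp_all

lemma delta_free_monomial_order: "delta_free (monomial gs) \<in> order_free (Suc (mono_order gs))"
proof (induction gs)
  case Nil
  then show ?case by (simp add: monomial_def derivation_1_eq_0 subspace_0[OF subspace_order_free])
next
  case (Cons g gs)
  have "delta_free (gen g) * monomial gs \<in> order_free (Suc (mono_order (g # gs)))"
    using gen_mult_order_free[OF monomial_order_free[OF refl],
        of "case_gen (\<lambda>i a. Hgen i (a + 1)) (\<lambda>i a. Cgen i (a + 1)) g" gs]
    by (cases g) (simp_all add: mono_order_def)
  moreover have "gen g * delta_free (monomial gs) \<in> order_free (Suc (mono_order (g # gs)))"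
    using gen_mult_order_free[OF Cons.IH, of g] by (simp add: mono_order_def)
  ultimately show ?case
    by (simp add: monomial_def delta_free_mult subspace_add[OF subspace_order_free])
qed

text \<open>The coefficient a(a - 1)/2 vanishes at both a = 0 and a = 1.\<close>

lemma sigma_free_gen_eq_0: "gen_order g \<le> 1 \<Longrightarrow> sigma_free (gen g) = 0"
  by (cases g) (auto simp: le_Suc_eq)

text \<open>Every generator in such a monomial has order at most 1, so each Leibniz term
  vanishes.\<close>

lemma sigma_free_monomial_eq_0: "mono_order gs \<le> 1 \<Longrightarrow> sigma_free (monomial gs) = 0"
  by (induction gs)
     (simp_all add: monomial_def mono_order_def derivation_1_eq_0 sigma_free_mult sigma_free_gen_eq_0)

text \<open>The truncated subtraction is harmless: where it could truncate, in either Leibniz term,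
  \<sigma> gives zero, and those cases are split off.\<close>

lemma sigma_free_monomial_order: "sigma_free (monomial gs) \<in> order_free (mono_order gs - 1)"
proof (induction gs)
  case Nil
  then show ?case by (simp add: monomial_def derivation_1_eq_0 subspace_0[OF subspace_order_free])
next
  case (Cons g gs)
  let ?o = "mono_order (g # gs) - 1"
  have "sigma_free (gen g) * monomial gs \<in> order_free ?o"
  proof (cases "gen_order g \<le> 1")
    case True
    then show ?thesis by (simp add: sigma_free_gen_eq_0 subspace_0[OF subspace_order_free])
  next
    case False
    then show ?thesis
      using gen_mult_order_free[OF monomial_order_free[OF refl], of "case_gen (\<lambda>i a. Hgen i (a - 1)) (\<lambda>i a. Cgen i (a - 1)) g" gs]
      by (cases g) (auto simp: mono_order_def intro!: subspace_scale[OF subspace_order_free])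
  qed
  moreover have "gen g * sigma_free (monomial gs) \<in> order_free ?o"
  proof (cases "mono_order gs = 0")
    case True
    then show ?thesis by (simp add: sigma_free_monomial_eq_0 subspace_0[OF subspace_order_free])
  next
    case False
    then show ?thesis
      using gen_mult_order_free[OF Cons.IH, of g] by (simp add: mono_order_def del: sum_list_eq_0_iff)
  qed
  ultimately show ?case
    by (simp add: monomial_def sigma_free_mult subspace_add[OF subspace_order_free])
qed

lemma delta_free_order: "x \<in> order_free k \<Longrightarrow> delta_free x \<in> order_free (Suc k)"
  by (rule order_free_linear[OF linear_delta_free subspace_order_free])
     (use delta_free_monomial_order in auto)

lemma sigma_free_order:
  assumes "x \<in> order_free (Suc k)"
  shows "sigma_free x \<in> order_free k"
proof (rule order_free_linear[OF linear_sigma_free subspace_order_free assms])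
  show "sigma_free (monomial gs) \<in> order_free k" if "mono_order gs = Suc k" for gs :: "'a gen list"
    using sigma_free_monomial_order[of gs] that by simp
qed

lemma sigma_free_order_01: "x \<in> order_free k \<Longrightarrow> k \<le> 1 \<Longrightarrow> sigma_free x = 0"
  using order_free_linear[OF linear_sigma_free subspace_single_0, of x k]
  by (auto simp: sigma_free_monomial_eq_0)

lemma sigma_delta_free_order:
  assumes "x \<in> order_free k"
  shows "sigma_free (delta_free x) = delta_free (sigma_free x) + real k *\<^sub>R x"
proof -
  let ?f = "\<lambda>x. sigma_free (delta_free x) - delta_free (sigma_free x) - real k *\<^sub>R x"
  have "?f x \<in> {0}"
    by (rule order_free_linear[OF _ subspace_single_0 assms])
       (auto intro!: linearI simp: sigma_delta_free_monomial algebra_simps)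
  then show ?thesis by (simp add: algebra_simps)
qed

section \<open>Passage to the truncated algebra and its cohomology\<close>

lemma linear_abs_DW: "linear (abs_DW :: 'q::finite free_DW \<Rightarrow> _)"
  by (rule linearI) (simp_all add: plus_DW.abs_eq scaleR_DW.abs_eq)

lemma DW_order_eq: "DW_order k = abs_DW ` order_free k"
  by (simp add: DW_order_def order_free_def)

lemma subspace_DW_order: "subspace (DW_order k)"
  unfolding DW_order_eq by (rule linear_subspace_image[OF linear_abs_DW subspace_order_free])

lemma delta_DW_order: "x \<in> DW_order k \<Longrightarrow> delta_DW x \<in> DW_order (Suc k)"
  by (auto simp: DW_order_eq delta_DW.abs_eq delta_free_order)

lemma sigma_DW_order: "x \<in> DW_order (Suc k) \<Longrightarrow> sigma_DW x \<in> DW_order k"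
  by (auto simp: DW_order_eq sigma_DW.abs_eq sigma_free_order)

lemma sigma_DW_order_01: "x \<in> DW_order k \<Longrightarrow> k \<le> 1 \<Longrightarrow> sigma_DW x = 0"
  by (auto simp: DW_order_eq sigma_DW.abs_eq sigma_free_order_01 zero_DW_def)

lemma sigma_delta_DW_order:
  "x \<in> DW_order k \<Longrightarrow> sigma_DW (delta_DW x) = delta_DW (sigma_DW x) + real k *\<^sub>R x"
  by (auto simp: DW_order_eq sigma_DW.abs_eq delta_DW.abs_eq sigma_delta_free_order
      plus_DW.abs_eq scaleR_DW.abs_eq)

lemma H_orderE:
  assumes "x \<in> H_order k"
  obtains z where "z \<in> DW_order k" "d_DW z = 0" "x = abs_HDW z"
  using assms by (auto simp: H_order_def)

lemma H_orderI: "z \<in> DW_order k \<Longrightarrow> d_DW z = 0 \<Longrightarrow> abs_HDW z \<in> H_order k"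
  by (auto simp: H_order_def)

text \<open>\<open>HDW\<close> is a partial quotient, defined on cocycles only, so computing on a
  representative carries the cocycle condition.\<close>

lemma delta_H_abs: "d_DW z = 0 \<Longrightarrow> delta_H (abs_HDW z) = abs_HDW (delta_DW z)"
  by (rule delta_H.abs_eq) (simp add: eq_onp_def)

lemma sigma_H_abs: "d_DW z = 0 \<Longrightarrow> sigma_H (abs_HDW z) = abs_HDW (sigma_DW z)"
  by (rule sigma_H.abs_eq) (simp add: eq_onp_def)

lemma plus_HDW_abs: "d_DW y = 0 \<Longrightarrow> d_DW z = 0 \<Longrightarrow> abs_HDW y + abs_HDW z = abs_HDW (y + z)"
  by (rule plus_HDW.abs_eq) (simp_all add: eq_onp_def)

lemma scaleR_HDW_abs: "d_DW z = 0 \<Longrightarrow> r *\<^sub>R abs_HDW z = abs_HDW (r *\<^sub>R z)"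
  by (rule scaleR_HDW.abs_eq) (simp add: eq_onp_def)

lemma d_DW_delta_sigma_eq_0: "d_DW z = 0 \<Longrightarrow> d_DW (delta_DW z) = 0" "d_DW z = 0 \<Longrightarrow> d_DW (sigma_DW z) = 0"
  by (simp_all flip: DW_simps(4,5))

text \<open>Each axiom is checked on a cocycle of the given order, where it follows from the
  corresponding fact about \<open>DW_order\<close>.\<close>

interpretation HDW: raising_lowering delta_H sigma_H H_order
proof (rule raising_lowering.intro)
  show "linear (delta_H :: 'a HDW \<Rightarrow> _)" "linear (sigma_H :: 'a HDW \<Rightarrow> _)"
    by (rule linear_delta_H linear_sigma_H)+
  fix k and x :: "'a HDW"
  show "subspace (H_order k :: 'a HDW set)"
  proof (rule subspaceI)
    show "(0 :: 'a HDW) \<in> H_order k"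
      unfolding zero_HDW_def by (rule H_orderI) (simp_all add: subspace_0[OF subspace_DW_order])
    show "x + y \<in> H_order k" if "x \<in> H_order k" "y \<in> H_order k" for x y :: "'a HDW"
      using that by (elim H_orderE) (simp add: plus_HDW_abs H_orderI subspace_add[OF subspace_DW_order])
    show "r *\<^sub>R x \<in> H_order k" if "x \<in> H_order k" for r and x :: "'a HDW"
      using that by (elim H_orderE) (simp add: scaleR_HDW_abs H_orderI subspace_scale[OF subspace_DW_order])
  qed
  show "delta_H x \<in> H_order (Suc k)" if "x \<in> H_order k"
    using that by (elim H_orderE) (simp add: delta_H_abs H_orderI delta_DW_order d_DW_delta_sigma_eq_0)
  show "sigma_H x \<in> H_order k" if "x \<in> H_order (Suc k)"
    using that by (elim H_orderE) (simp add: sigma_H_abs H_orderI sigma_DW_order d_DW_delta_sigma_eq_0)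
  show "sigma_H x = 0" if "x \<in> H_order k" "k \<le> 1"
    using that by (elim H_orderE) (simp add: sigma_H_abs sigma_DW_order_01 zero_HDW_def)
  show "sigma_H (delta_H x) = delta_H (sigma_H x) + real k *\<^sub>R x" if "x \<in> H_order k"
    using that by (elim H_orderE)
      (simp add: sigma_H_abs delta_H_abs plus_HDW_abs scaleR_HDW_abs d_DW_delta_sigma_eq_0 sigma_delta_DW_order)
qed

lemma F_space_eq: "F_space = HDW.F"
  by (simp add: fun_eq_iff F_space_def HDW.F_def)

section \<open>Transfer of the abstract results to the cohomology\<close>

theorem theorem9p10:
  shows "
    ((H_order 0 :: 'q::finite HDW set) = F_space 0 0 \<and>
     (\<forall>k\<ge>1. internal_direct_sum {1..k} (\<lambda>m. F_space (eigval m k) k) (H_order k :: 'q HDW set)))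
    \<and>
    ((\<exists>S :: 'q HDW set.
        internal_direct_sum {(n :: int, k :: nat). n \<ge> 1 \<and> k \<ge> 2}
          (\<lambda>(n, k). F_space (of_int n) k) S \<and>
        linear (sigma_H :: 'q HDW \<Rightarrow> 'q HDW) \<and> inj_on sigma_H S) \<and>
     (\<exists>S :: 'q HDW set.
        internal_direct_sum {k :: nat. k \<ge> 1} H_order S \<and>
        linear (delta_H :: 'q HDW \<Rightarrow> 'q HDW) \<and> inj_on delta_H S))
    \<and>
    (\<forall>k\<ge>1. 
       (\<forall>x \<in> (H_order k :: 'q HDW set).
          proj_F 1 k x =
            (\<Sum>i = 0..k - 1.
               ((- 1) ^ i * (2 ^ i * fact (2 * k - i - 2) / (fact (2 * k - 2) * fact i)))
                 *\<^sub>R (delta_H ^^ i) ((sigma_H ^^ i) x))) \<and>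
       (\<forall>a\<le>k - 1. \<forall>x \<in> (H_order k :: 'q HDW set).
          proj_F (k - a) k x =
            (2 ^ (k - a - 1) * fact (2 * a + 1) / (fact (k - a - 1) * fact (k + a)))
              *\<^sub>R (delta_H ^^ (k - a - 1)) (proj_F 1 (a + 1) ((sigma_H ^^ (k - a - 1)) x))))"
proof -
  \<comment> \<open>In order 0, \<sigma> vanishes, so every element has eigenvalue 0.\<close>
  have "(H_order 0 :: 'q HDW set) = F_space 0 0"
    unfolding F_space_eq using HDW.F_0_iff HDW.lower_V_01 by blast
  moreover have "\<forall>k\<ge>1. internal_direct_sum {1..k} (\<lambda>m. F_space (eigval m k) k) (H_order k :: 'q HDW set)"
    unfolding F_space_eq using HDW.direct_sum_V by blast
  \<comment> \<open>The witness \<open>S\<close> is the span of the summands, fixed by unification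
    with \<open>HDW.direct_sum_F\<close>; n \<ge> 1 makes the eigenvalues nonzero.\<close>
  moreover have "\<exists>S :: 'q HDW set.
      internal_direct_sum {(n :: int, k :: nat). n \<ge> 1 \<and> k \<ge> 2} (\<lambda>(n, k). F_space (of_int n) k) S \<and>
      linear (sigma_H :: 'q HDW \<Rightarrow> 'q HDW) \<and> inj_on sigma_H S"
    unfolding F_space_eq
    by (intro exI conjI, rule HDW.direct_sum_F, rule linear_sigma_H, rule HDW.inj_on_lower) auto
  moreover have "\<exists>S :: 'q HDW set. internal_direct_sum {k :: nat. k \<ge> 1} H_order S \<and>
      linear (delta_H :: 'q HDW \<Rightarrow> 'q HDW) \<and> inj_on delta_H S"
    by (intro exI conjI, rule HDW.direct_sum_all_V, rule linear_delta_H, rule HDW.inj_on_raise)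
  moreover have "proj_F 1 k x = (\<Sum>i = 0..k - 1.
      ((- 1) ^ i * (2 ^ i * fact (2 * k - i - 2) / (fact (2 * k - 2) * fact i)))
        *\<^sub>R (delta_H ^^ i) ((sigma_H ^^ i) x))"
    if "k \<ge> 1" "x \<in> H_order k" for k and x :: "'q HDW"
    using HDW.proj_1[OF that(2,1)]
    by (simp add: proj_F_def F_space_eq HDW.ker_proj_def ker_coeff_def)
  moreover have "proj_F (k - a) k x =
      (2 ^ (k - a - 1) * fact (2 * a + 1) / (fact (k - a - 1) * fact (k + a)))
        *\<^sub>R (delta_H ^^ (k - a - 1)) (proj_F 1 (a + 1) ((sigma_H ^^ (k - a - 1)) x))"
    if "k \<ge> 1" "a \<le> k - 1" "x \<in> H_order k" for k a and x :: "'q HDW"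
    unfolding proj_F_def F_space_eq using that by (intro HDW.proj_formula) auto
  ultimately show ?thesis by blast
qed

end
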